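(* Let $m\le n$ be positive integers. The inductive volume measure $\mathcal{H}_{m\leq n}$ is the smallest Borel measure on $\mathbb{R}^n$ that satisfies the Area Formula and is inner regular on sets of finite measure. That is, $\mathcal{H}_{m\leq n}$ satisfies the Area Formula and is inner regular on Borel sets of finite measure, and if $\nu\colon Bo(\mathbb{R}^n)\to[0,\infty]$ is any measure that satisfies the Area Formula and is inner regular on Borel sets of finite $\nu$-measure, then $\mathcal{H}_{m\leq n}(A)\le\nu(A)$ for every $A\in Bo(\mathbb{R}^n)$.
   Context: Submanifold of $\mathbb{R}^n$ means embedded $C^1$ submanifold without boundary (not necessarily closed or connected), with the Riemannian metric induced from $\mathbb{R}^n$. For an $m$-dimensional submanifold $M$, $\mu_M$ is its volume measure: the unique Borel measure on $M$ such that for every local parametrization $\varphi\colon U\subset\mathbb{R}^m\to M$ and Borel $E\subset U$, $\mu_M(\varphi(E))=\int_E\sqrt{\det(D\varphi^{t}D\varphi)}\,dx$. Definition of $\mathcal{H}_{m\leq n}$. Let $\mathcal{C}_m$ be the class of Borel subsets of $\mathbb{R}^n$ contained in some $m$-dimensional submanifold. For $C\in\mathcal{C}_m$ with $C\subset S$, $S$ such a submanifold, put $\mu_C(A)=\mu_S(A\cap C)$ for Borel $A$ (independent of $S$). Let $I_m$ be the class of finite disjoint unions $\tilde M=\biguplus_{i=1}^{k}C_i$ of elements of $\mathcal{C}_m$, directed by inclusion, and put $\mu_{\tilde M}=\sum_{i=1}^{k}\mu_{C_i}$ (independent of the decomposition). The inductive volume measure is $$\mathcal{H}_{m\leq n}(A)=\lim_{\tilde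 M\in I_m}\mu_{\tilde M}(A)=\sup_{\tilde M\in I_m}\mu_{\tilde M}(A),\qquad A\in Bo(\mathbb{R}^n),$$ a measure on the Borel $\sigma$-algebra $Bo(\mathbb{R}^n)$. A Borel measure $\nu$ on $\mathbb{R}^n$ satisfies the Area Formula (in dimension $m$) if $\nu(A)=\sum_{k=1}^{\infty}\mu_{M_k}(A\cap M_k)$ for every Borel set $A$ contained in the union of a sequence $(M_k)_{k\in\mathbb{N}}$ of pairwise disjoint $m$-dimensional submanifolds. It is inner regular on sets of finite measure if $\nu(A)=\sup\{\nu(K)\mid K\subset A,\ K\text{ compact}\}$ whenever $A$ is Borel and $\nu(A)<\infty$. *)

theory Defs
  imports "HOL-Analysis.Analysis"
begin

text \<open>
  The ambient space is \<open>real^'n\<close>. The dimension \<open>m\<close> of the submanifolds is \<open>CARD('m)\<close>; since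
  \<open>'m\<close> does not occur in the type of a subset of \<open>real^'n\<close>, it is passed as an argument of type
  \<open>'m itself\<close>.
\<close>

definition local_parametrization ::
    "(real^'n::finite) set \<Rightarrow> (real^'m::finite) set \<Rightarrow> (real^'m \<Rightarrow> real^'n) \<Rightarrow> bool" where
  "local_parametrization M U \<phi> \<longleftrightarrow>
     open U \<and>
     (\<forall>x\<in>U. \<phi> differentiable (at x)) \<and>
     continuous_on U (\<lambda>x. jacobian \<phi> (at x)) \<and>
     (\<forall>x\<in>U. inj (frechet_derivative \<phi> (at x))) \<and>
     openin (top_of_set M) (\<phi> ` U) \<and>
     (\<exists>\<psi>. homeomorphism U (\<phi> ` U) \<phi> \<psi>)"

text \<open>
  Embedded \<open>C\<^sup>1\<close> submanifold without boundary, not necessarily closed or connected. The empty set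
  is a submanifold of every dimension.
\<close>

definition submanifold :: "'m::finite itself \<Rightarrow> (real^'n::finite) set \<Rightarrow> bool" where
  "submanifold T M \<longleftrightarrow>
     (\<forall>p\<in>M. \<exists>(U :: (real^'m) set) \<phi>. local_parametrization M U \<phi> \<and> p \<in> \<phi> ` U)"

definition is_volume_measure ::
    "'m::finite itself \<Rightarrow> (real^'n::finite) set \<Rightarrow> (real^'n) measure \<Rightarrow> bool" where
  "is_volume_measure T M \<mu> \<longleftrightarrow>
     sets \<mu> = sets (restrict_space borel M) \<and>
     (\<forall>(U :: (real^'m) set) \<phi> E. local_parametrization M U \<phi> \<longrightarrow> E \<in> sets borel \<longrightarrow> E \<subseteq> U \<longrightarrow>
        emeasure \<mu> (\<phi> ` E) =
          (\<integral>\<^sup>+x\<in>E. ennreal (sqrt (det (transpose (jacobian \<phi> (at x)) ** jacobian \<phi> (at x)))) \<partial>lborel))"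

definition volume_measure ::
    "'m::finite itself \<Rightarrow> (real^'n::finite) set \<Rightarrow> (real^'n) measure" where
  "volume_measure T M = (THE \<mu>. is_volume_measure T M \<mu>)"

definition borel_pieces :: "'m::finite itself \<Rightarrow> (real^'n::finite) set set" where
  "borel_pieces T = {C. C \<in> sets borel \<and> (\<exists>S. submanifold T S \<and> C \<subseteq> S)}"

text \<open>The value of \<open>piece_volume\<close> does not depend on the choice of \<open>S\<close>.\<close>

definition piece_volume ::
    "'m::finite itself \<Rightarrow> (real^'n::finite) set \<Rightarrow> (real^'n) set \<Rightarrow> ennreal" where
  "piece_volume T C A =
     emeasure (volume_measure T (SOME S. submanifold T S \<and> C \<subseteq> S)) (A \<inter> C)"

definition is_decomposition ::
    "'m::finite itself \<Rightarrow> (real^'n::finite) set \<Rightarrow> (real^'n) set set \<Rightarrow> bool" where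
  "is_decomposition T M \<C> \<longleftrightarrow> finite \<C> \<and> \<C> \<subseteq> borel_pieces T \<and> disjoint \<C> \<and> M = \<Union>\<C>"

definition finite_unions :: "'m::finite itself \<Rightarrow> (real^'n::finite) set set" where
  "finite_unions T = {M. \<exists>\<C>. is_decomposition T M \<C>}"

text \<open>The value of \<open>union_volume\<close> does not depend on the choice of the decomposition.\<close>

definition union_volume ::
    "'m::finite itself \<Rightarrow> (real^'n::finite) set \<Rightarrow> (real^'n) set \<Rightarrow> ennreal" where
  "union_volume T M A = (\<Sum>C\<in>(SOME \<C>. is_decomposition T M \<C>). piece_volume T C A)"

definition inductive_volume ::
    "'m::finite itself \<Rightarrow> (real^'n::finite) set \<Rightarrow> ennreal" where
  "inductive_volume T A = (SUP M\<in>finite_unions T. union_volume T M A)"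

text \<open>
  \<open>measure_of\<close> yields the null measure unless \<open>inductive_volume T\<close> is countably additive on the
  Borel sets.
\<close>

definition inductive_volume_measure ::
    "'m::finite itself \<Rightarrow> (real^'n::finite) measure" where
  "inductive_volume_measure T = measure_of UNIV (sets borel) (inductive_volume T)"

text \<open>
  Sequences of submanifolds are indexed from \<open>0\<close>.
\<close>

definition satisfies_area_formula ::
    "'m::finite itself \<Rightarrow> (real^'n::finite) measure \<Rightarrow> bool" where
  "satisfies_area_formula T \<nu> \<longleftrightarrow>
     (\<forall>(M :: nat \<Rightarrow> (real^'n) set) A.
        (\<forall>k. submanifold T (M k)) \<longrightarrow> disjoint_family M \<longrightarrow> A \<in> sets borel \<longrightarrow> A \<subseteq> (\<Union>k. M k) \<longrightarrow>
        emeasure \<nu> A = (\<Sum>k. emeasure (volume_measure T (M k)) (A \<inter> M k)))"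

definition inner_regular_on_finite :: "(real^'n::finite) measure \<Rightarrow> bool" where
  "inner_regular_on_finite \<nu> \<longleftrightarrow>
     (\<forall>A\<in>sets borel. emeasure \<nu> A < \<infinity> \<longrightarrow>
        emeasure \<nu> A = (SUP K\<in>{K. compact K \<and> K \<subseteq> A}. emeasure \<nu> K))"

end

theory Submission
  imports Defs
begin

text \<open>
  The core is that the area of a Borel set \<open>B\<close> does not depend on the parametrization used to compute
  it, even if \<open>\<phi>\<close> and \<open>\<psi>\<close> parametrize different submanifolds that both contain \<open>B\<close>. The transition
  map \<open>h = \<psi>\<^sup>-\<^sup>1 \<circ> \<phi>\<close> is then defined only on the Borel set \<open>\<phi>\<^sup>-\<^sup>1(B)\<close>, but it is differentiable within that
  set because \<open>D\<psi>\<close> is injective, and \<open>D\<phi> = D\<psi> \<circ> Dh\<close> almost everywhere, since derivatives within a set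
  are unique almost everywhere on it. The change of variables formula does the rest. With this, the
  volume measures of submanifolds exist and agree on overlaps, and the inductive volume is the
  supremum of a directed family of measures, hence a measure. Inner regularity holds for
  every Borel measure on \<open>real^'n\<close>, and any measure satisfying the Area Formula agrees with the
  inductive volume on pieces of submanifolds and therefore dominates it.
\<close>

section \<open>Derivatives within a set and change of variables\<close>

text \<open>
  Where the two derivatives differ by \<open>D \<noteq> 0\<close>, the identity also has the within-derivative
  \<open>I - L \<circ> D\<close> for every linear \<open>L\<close>; choosing \<open>L\<close> so that this map is singular, Sard's theorem applies
  to the identity.
\<close>

lemma negligible_derivative_within_nonunique:
  fixes f :: "real^'m::{finite,wellorder} \<Rightarrow> real^'n"
  assumes D1: "\<And>x. x \<in> E \<Longrightarrow> (f has_derivative f1 x) (at x within E)"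
      and D2: "\<And>x. x \<in> E \<Longrightarrow> (f has_derivative f2 x) (at x within E)"
  shows "negligible {x \<in> E. f1 x \<noteq> f2 x}"
proof -
  define N where "N = {x \<in> E. f1 x \<noteq> f2 x}"
  define D where "D x = (\<lambda>h. f1 x h - f2 x h)" for x
  have "\<exists>v. f1 x v \<noteq> f2 x v" if "x \<in> N" for x
    using that by (auto simp: N_def)
  then obtain v where v: "\<And>x. x \<in> N \<Longrightarrow> D x (v x) \<noteq> 0"
    unfolding D_def by (metis eq_iff_diff_eq_0)
  \<comment> \<open>Here \<open>L w = ((w \<bullet> D x (v x)) / (D x (v x) \<bullet> D x (v x)))
    *\<^sub>R v x\<close>. The factor is 1 at \<open>w = D x (v x)\<close>, so \<open>v x\<close>
    lies in the kernel of \<open>g x\<close>.\<close>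
  define g where "g x = (\<lambda>h. h - ((D x h \<bullet> D x (v x)) / (D x (v x) \<bullet> D x (v x))) *\<^sub>R v x)" for x
  have der: "((\<lambda>x. x) has_derivative g x) (at x within N)" if x: "x \<in> N" for x
  proof -
    have "((\<lambda>y. y - ((k y \<bullet> D x (v x)) / (D x (v x) \<bullet> D x (v x))) *\<^sub>R v x)
        has_derivative g x) (at x within N)" if "(k has_derivative D x) (at x within N)" for k
      unfolding g_def using that v[OF x] by (auto intro!: derivative_eq_intros)
    \<comment> \<open>Both derivatives belong to \<open>f\<close>, so their difference
      \<open>D x\<close> is a derivative of the zero function. Taking that function for
      \<open>k\<close> turns the map above into the identity.\<close>
    moreover have "((\<lambda>x. f x - f x) has_derivative D x) (at x within N)"
      unfolding D_def
      using x D1 D2 by (intro has_derivative_diff) (auto simp: N_def intro: has_derivative_subset)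
    ultimately have "((\<lambda>y. y - (((f y - f y) \<bullet> D x (v x)) / (D x (v x) \<bullet> D x (v x))) *\<^sub>R v x)
        has_derivative g x) (at x within N)" .
    then show ?thesis by simp
  qed
  have rank: "rank (matrix (g x)) < CARD('m)" if x: "x \<in> N" for x
  proof -
    have lin: "linear (g x)" using der[OF x] by (rule has_derivative_linear)
    have "g x (v x) = 0" using v[OF x] by (simp add: g_def)
    moreover have "v x \<noteq> 0"
    proof
      assume "v x = 0"
      moreover have "linear (D x)"
        unfolding D_def using x D1 D2
        by (intro linear_compose_sub) (auto simp: N_def intro: has_derivative_linear)
      ultimately show False using v[OF x] by (simp add: linear_0)
    qed
    moreover have "(*v) (matrix (g x)) = g x"
      using matrix_vector_mul(2)[OF lin] .
    ultimately have "\<not> inj ((*v) (matrix (g x)))"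
      using lin linear_0[OF lin] by (metis injD)
    then show ?thesis by (simp add: less_rank_noninjective)
  qed
  have "negligible ((\<lambda>x. x) ` N)"
    by (rule baby_Sard[OF order_refl der rank])
  then show ?thesis by (simp add: N_def)
qed

text \<open>The determinant is never negative; \<open>max 0\<close> only avoids having to prove this.\<close>

definition gram_density :: "real^'m^'n \<Rightarrow> real" where
  "gram_density A = max 0 (sqrt (det (transpose A ** A)))"

lemma gram_density_nonneg [simp]: "0 \<le> gram_density A"
  by (simp add: gram_density_def)

lemma ennreal_gram_density: "ennreal (gram_density A) = ennreal (sqrt (det (transpose A ** A)))"
  by (simp add: gram_density_def max_def ennreal_neg)

text \<open>This is how the area density transforms under a change of parameters with derivative
  \<open>B\<close>: the Gram matrix becomes \<open>transpose B ** (transpose A ** A) ** B\<close>,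
  and the square matrix \<open>B\<close> contributes its determinant twice under the root.\<close>

lemma gram_density_mult:
  fixes A :: "real^'m^'n" and B :: "real^'m^'m"
  shows "gram_density (A ** B) = \<bar>det B\<bar> * gram_density A"
proof -
  have "transpose (A ** B) ** (A ** B) = transpose B ** ((transpose A ** A) ** B)"
    by (simp add: matrix_transpose_mul matrix_mul_assoc)
  then have "det (transpose (A ** B) ** (A ** B)) = (det B)\<^sup>2 * det (transpose A ** A)"
    by (simp add: det_mul power2_eq_square)
  then show ?thesis
    by (simp add: gram_density_def real_sqrt_mult max_def mult_le_0_iff zero_le_mult_iff)
qed

text \<open>Extends the change of variables for absolutely integrable functions to nonnegative ones:
  either both sides are integrable with equal integrals, or both integrals are infinite. The set
  \<open>N\<close> leaves room for a transformation law that holds only almost everywhere.\<close>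

lemma nn_integral_change_of_variables_within:
  fixes h :: "real^'m::{finite,wellorder} \<Rightarrow> real^'m::{finite,wellorder}"
  assumes E: "E \<in> sets borel" and F: "h ` E \<in> sets borel"
    and der: "\<And>x. x \<in> E \<Longrightarrow> (h has_derivative h' x) (at x within E)"
    and inj: "inj_on h E"
    and f: "set_borel_measurable borel E f" and g: "set_borel_measurable borel (h ` E) g"
    and f0: "\<And>x. x \<in> E \<Longrightarrow> 0 \<le> f x" and g0: "\<And>y. y \<in> h ` E \<Longrightarrow> 0 \<le> g y"
    and N: "negligible N"
    and eq: "\<And>x. x \<in> E - N \<Longrightarrow> f x = \<bar>det (matrix (h' x))\<bar> * g (h x)"
  shows "(\<integral>\<^sup>+x\<in>E. ennreal (f x) \<partial>lborel) = (\<integral>\<^sup>+y\<in>h ` E. ennreal (g y) \<partial>lborel)"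
proof -
  \<comment> \<open>Since \<open>b\<close> is arbitrary, this equivalence transports both
    integrability and the value of the integral.\<close>
  have *: "f absolutely_integrable_on E \<and> integral E f = b \<longleftrightarrow>
      g absolutely_integrable_on (h ` E) \<and> integral (h ` E) g = b" for b
  proof -
    \<comment> \<open>The change of variables theorem concerns functions with values in a space
      \<open>real^'k\<close>, so the scalar density is viewed in \<open>real^1\<close>.\<close>
    let ?lift = "vec :: real \<Rightarrow> real^1"
    let ?d = "\<lambda>x. \<bar>det (matrix (h' x))\<bar> * g (h x)"
    have E': "E \<in> sets lebesgue" using E by simp
    have "?d absolutely_integrable_on E \<and> integral E ?d = b \<longleftrightarrow>
      g absolutely_integrable_on (h ` E) \<and> integral (h ` E) g = b"
      using has_absolute_integral_change_of_variables[OF E' der inj, of "\<lambda>x. ?lift (g x)" "?lift b"]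
      by (auto simp: absolutely_integrable_on_1_iff integral_on_1_eq vec_eq_iff)
    moreover have "f absolutely_integrable_on E \<longleftrightarrow> ?d absolutely_integrable_on E"
      using absolutely_integrable_spike_eq[OF N, of E ?d f] eq by auto
    moreover have "integral E f = integral E ?d"
      using eq by (intro integral_spike[OF N]) auto
    ultimately show ?thesis by simp
  qed
  have iff: "k absolutely_integrable_on X \<longleftrightarrow> (\<integral>\<^sup>+x\<in>X. ennreal (k x) \<partial>lborel) < \<infinity>"
    if "X \<in> sets borel" "set_borel_measurable borel X k" "\<And>x. x \<in> X \<Longrightarrow> 0 \<le> k x"
    for X and k :: "real^'m::{finite,wellorder} \<Rightarrow> real"
  proof -
    have k: "(\<lambda>x. indicat_real X x *\<^sub>R k x) \<in> borel_measurable lborel"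
      using that by (simp add: set_borel_measurable_def)
    have "k absolutely_integrable_on X \<longleftrightarrow> integrable lborel (\<lambda>x. indicat_real X x *\<^sub>R k x)"
      unfolding set_integrable_def using k by (simp add: integrable_completion)
    also have "\<dots> \<longleftrightarrow> (\<integral>\<^sup>+x. ennreal (norm (indicat_real X x *\<^sub>R k x)) \<partial>lborel) < \<infinity>"
      using k by (simp add: integrable_iff_bounded)
    also have "(\<integral>\<^sup>+x. ennreal (norm (indicat_real X x *\<^sub>R k x)) \<partial>lborel) = (\<integral>\<^sup>+x\<in>X. ennreal (k x) \<partial>lborel)"
      using that by (intro nn_integral_cong) (auto simp: indicator_def)
    finally show ?thesis .
  qed
  show ?thesis
  proof (cases "f absolutely_integrable_on E")
    case True
    then have 1: "g absolutely_integrable_on (h ` E)" "integral (h ` E) g = integral E f"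
      using * by blast+
    have "(\<integral>\<^sup>+x\<in>E. ennreal (f x) \<partial>lborel) = ennreal (integral E f)"
      using iff[OF E f f0] True f0 f by (intro set_nn_integral_lborel_eq_integral) auto
    moreover have "(\<integral>\<^sup>+x\<in>h ` E. ennreal (g x) \<partial>lborel) = ennreal (integral (h ` E) g)"
      using iff[OF F g g0] 1 g0 g by (intro set_nn_integral_lborel_eq_integral) auto
    ultimately show ?thesis using 1 by simp
  next
    case False
    then have "\<not> g absolutely_integrable_on (h ` E)" using * by blast
    with False iff[OF E f f0] iff[OF F g g0] show ?thesis
      by (simp add: less_top[symmetric])
  qed
qed

lemma continuous_on_gram_density:
  fixes A :: "'a::topological_space \<Rightarrow> real^'m^'n"
  assumes "continuous_on S A"
  shows "continuous_on S (\<lambda>x. gram_density (A x))"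
proof -
  have "continuous_on S (\<lambda>x. A x $ i $ j)" for i j
    using assms by (intro continuous_intros)
  then show ?thesis
    unfolding gram_density_def det_def matrix_matrix_mult_def transpose_def
    using assms by (auto intro!: continuous_intros)
qed

text \<open>\<open>E\<close> and \<open>F\<close> need not be open, so the transition map is
  differentiated only within \<open>E\<close>. Continuity of the inverse \<open>g\<close> on the
  image of \<open>F\<close>, together with injectivity of each \<open>C y\<close>, provides that
  derivative.\<close>

lemma chart_area_eq_wellorder:
  fixes \<phi> \<psi> :: "real^'m::{finite,wellorder} \<Rightarrow> real^'n"
  assumes d\<phi>: "\<And>x. x \<in> E \<Longrightarrow> (\<phi> has_derivative (*v) (A x)) (at x)"
    and contA: "continuous_on E A" and inj\<phi>: "inj_on \<phi> E"
    and d\<psi>: "\<And>y. y \<in> F \<Longrightarrow> (\<psi> has_derivative (*v) (C y)) (at y)"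
    and contC: "continuous_on F C" and injC: "\<And>y. y \<in> F \<Longrightarrow> inj ((*v) (C y))"
    and g: "\<And>y. y \<in> F \<Longrightarrow> g (\<psi> y) = y" "continuous_on (\<psi> ` F) g"
    and E: "E \<in> sets borel" and F: "F \<in> sets borel" and EF: "\<phi> ` E = \<psi> ` F"
  shows "(\<integral>\<^sup>+x\<in>E. ennreal (gram_density (A x)) \<partial>lborel) = (\<integral>\<^sup>+y\<in>F. ennreal (gram_density (C y)) \<partial>lborel)"
proof -
  define h where "h = g \<circ> \<phi>"
  have hE: "h ` E = F"
  proof -
    have "h ` E = g ` \<psi> ` F" by (simp add: h_def image_comp flip: EF)
    then show ?thesis using g(1) by (simp add: image_image)
  qed
  have \<psi>h: "\<psi> (h x) = \<phi> x" if "x \<in> E" for x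
  proof -
    obtain y where "y \<in> F" "\<phi> x = \<psi> y"
      using imageI[OF \<open>x \<in> E\<close>, of \<phi>] unfolding EF by blast
    then show ?thesis by (simp add: h_def g(1))
  qed
  have hF: "h x \<in> F" if "x \<in> E" for x using hE that by blast
  have injh: "inj_on h E"
  proof (rule inj_onI)
    fix x y assume "x \<in> E" "y \<in> E" "h x = h y"
    then have "\<phi> x = \<phi> y" using \<psi>h[of x] \<psi>h[of y] by simp
    then show "x = y" using inj_onD[OF inj\<phi>] \<open>x \<in> E\<close> \<open>y \<in> E\<close> by blast
  qed
  \<comment> \<open>A linear left inverse of \<open>C y\<close> is the candidate for the derivative
    of \<open>g\<close> at \<open>\<psi> y\<close>, taken within the image of
    \<open>F\<close>.\<close>
  have "\<forall>y\<in>F. \<exists>p. linear p \<and> p \<circ> (*v) (C y) = id"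
    using linear_injective_left_inverse[OF matrix_vector_mul_linear injC] by blast
  then obtain P where P: "\<And>y. y \<in> F \<Longrightarrow> linear (P y) \<and> P y \<circ> (*v) (C y) = id"
    unfolding bchoice_iff by blast
  define h' where "h' x = P (h x) \<circ> (*v) (A x)" for x
  have derh: "(h has_derivative h' x) (at x within E)" if x: "x \<in> E" for x
  proof -
    have "continuous (at (\<psi> (h x)) within \<psi> ` F) g"
      using g(2) hF[OF x] by (auto simp: continuous_on_eq_continuous_within)
    then have "(g has_derivative P (h x)) (at (\<psi> (h x)) within \<psi> ` F)"
      using P[OF hF[OF x]] hF[OF x] g(1)
      by (intro has_derivative_inverse_within[OF has_derivative_at_withinI[OF d\<psi>]]) auto
    then have "(g has_derivative P (h x)) (at (\<phi> x) within \<phi> ` E)"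
      using \<psi>h[OF x] EF by simp
    then show ?thesis
      unfolding h_def h'_def[unfolded h_def]
      by (intro diff_chain_within has_derivative_at_withinI[OF d\<phi>] x)
  qed
  \<comment> \<open>On \<open>E\<close> one has \<open>\<phi> = \<psi> \<circ> h\<close>, so the
    chain rule gives \<open>\<phi>\<close> a second derivative within \<open>E\<close>. It may
    differ from \<open>A x\<close> only on a negligible set.\<close>
  have der2: "(\<phi> has_derivative (*v) (C (h x)) \<circ> h' x) (at x within E)" if x: "x \<in> E" for x
  proof -
    have "(\<psi> \<circ> h has_derivative (*v) (C (h x)) \<circ> h' x) (at x within E)"
      using x hF by (intro diff_chain_within derh has_derivative_at_withinI[OF d\<psi>]) auto
    then show ?thesis
      by (rule has_derivative_transform[OF x, rotated]) (simp add: \<psi>h)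
  qed
  define N where "N = {x \<in> E. (*v) (A x) \<noteq> (*v) (C (h x)) \<circ> h' x}"
  have negN: "negligible N"
    unfolding N_def
    by (rule negligible_derivative_within_nonunique[OF has_derivative_at_withinI[OF d\<phi>] der2])
  have eq: "gram_density (A x) = \<bar>det (matrix (h' x))\<bar> * gram_density (C (h x))" if x: "x \<in> E - N" for x
  proof -
    have "matrix ((*v) (A x)) = matrix ((*v) (C (h x)) \<circ> h' x)"
      using x by (simp add: N_def)
    also have "\<dots> = C (h x) ** matrix (h' x)"
      using x has_derivative_linear[OF derh[of x]] by (simp add: matrix_compose)
    finally show ?thesis by (simp add: gram_density_mult)
  qed
  have m: "set_borel_measurable borel X (\<lambda>x. gram_density (K x))"
    if "X \<in> sets borel" "continuous_on X K" for X and K :: "real^'m::{finite,wellorder} \<Rightarrow> real^'m::{finite,wellorder}^'n"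
    unfolding set_borel_measurable_def
    using that by (intro borel_measurable_continuous_on_indicator continuous_on_gram_density)
  show ?thesis
    using nn_integral_change_of_variables_within[OF E _ derh injh m[OF E contA] _ _ _ negN eq] m[OF F contC] F
    by (simp add: hE)
qed

section \<open>Transfer to arbitrary finite index types\<close>

text \<open>
  Sard's theorem and the change of variables formula are available only for index types of class
  \<open>wellorder\<close>. The type \<open>'a idx\<close> is a well-ordered copy of the finite type \<open>'a\<close>, to which the
  coordinates are transferred.
\<close>

typedef (overloaded) 'a idx = "{..<CARD('a::finite)}"
  by (rule exI[of _ 0]) simp

instantiation idx :: (finite) linorder
begin
definition "less_eq_idx (x :: 'a idx) (y :: 'a idx) \<longleftrightarrow> Rep_idx x \<le> Rep_idx y"
definition "less_idx (x :: 'a idx) (y :: 'a idx) \<longleftrightarrow> Rep_idx x < Rep_idx y"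
instance
  by intro_classes (auto simp: less_eq_idx_def less_idx_def Rep_idx_inject)
end

instance idx :: (finite) finite
proof
  show "finite (UNIV :: 'a idx set)"
    by (simp add: type_definition.univ[OF type_definition_idx])
qed

instance idx :: (finite) wellorder
proof
  fix P :: "'a idx \<Rightarrow> bool" and a
  assume step: "\<And>x. (\<And>y. y < x \<Longrightarrow> P y) \<Longrightarrow> P x"
  show "P a"
  proof (induction a rule: measure_induct_rule[of Rep_idx])
    case (less x)
    show ?case
      by (rule step) (rule less, simp only: less_idx_def)
  qed
qed

lemma ex_bij_idx: "\<exists>b :: 'a::finite idx \<Rightarrow> 'a. bij b"
proof -
  have "card (UNIV :: 'a idx set) = CARD('a)"
    using type_definition.card[OF type_definition_idx] by simp
  then show ?thesis
    using finite_same_card_bij[of "UNIV :: 'a idx set" "UNIV :: 'a set"] by auto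
qed

definition permute_coords :: "('k \<Rightarrow> 'm) \<Rightarrow> 'a^'m \<Rightarrow> 'a^'k" where
  "permute_coords b x = (\<chi> i. x $ b i)"

lemma permute_coords_nth [simp]: "permute_coords b x $ i = x $ b i"
  by (simp add: permute_coords_def)

lemma permute_coords_inv:
  assumes "bij b"
  shows "permute_coords (inv b) (permute_coords b x) = x" "permute_coords b (permute_coords (inv b) y) = y"
  using assms by (simp_all add: vec_eq_iff bij_is_surj surj_f_inv_f bij_is_inj inv_f_f)

lemma linear_permute_coords: "linear (permute_coords b :: real^'m \<Rightarrow> real^'k)"
  by (rule linearI) (auto simp: vec_eq_iff)

text \<open>The preimage of a box is the box with permuted side lengths, which has the same volume,
  and Lebesgue measure is determined by its values on boxes.\<close>

lemma lborel_distr_permute_coords: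
  fixes b :: "'k::finite \<Rightarrow> 'm::finite"
  assumes "bij b"
  shows "distr lborel borel (permute_coords b :: real^'m \<Rightarrow> real^'k) = lborel"
proof (rule sym, rule lborel_eqI)
  fix l u :: "real^'k" assume lu: "\<And>c. c \<in> Basis \<Longrightarrow> l \<bullet> c \<le> u \<bullet> c"
  have [measurable]: "(permute_coords b :: real^'m \<Rightarrow> real^'k) \<in> borel_measurable borel"
    by (intro borel_measurable_continuous_onI linear_continuous_on linear_conv_bounded_linear[THEN iffD1] linear_permute_coords)
  let ?r = "permute_coords (inv b) :: real^'k \<Rightarrow> real^'m"
  have lu': "l $ i \<le> u $ i" for i
    using lu[of "axis i 1"] by (simp add: inner_axis)
  have "(permute_coords b :: real^'m \<Rightarrow> real^'k) -` box l u = box (?r l) (?r u)"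
  proof -
    have q: "(\<forall>i. Q i (b i)) \<longleftrightarrow> (\<forall>j. Q (inv b j) j)" for Q
      using assms by (metis bij_inv_eq_iff)
    have "x \<in> (permute_coords b :: real^'m \<Rightarrow> real^'k) -` box l u \<longleftrightarrow> x \<in> box (?r l) (?r u)" for x
      using q[of "\<lambda>i j. l $ i < x $ j \<and> x $ j < u $ i"]
      by (simp add: mem_box_cart)
    then show ?thesis by blast
  qed
  then have "emeasure (distr lborel borel (permute_coords b)) (box l u) = emeasure lborel (box (?r l) (?r u))"
    by (simp add: emeasure_distr)
  also have "\<dots> = (\<Prod>c\<in>Basis. (?r u - ?r l) \<bullet> c)"
    by (rule emeasure_lborel_box) (auto simp: Basis_vec_def inner_axis lu')
  also have "(\<Prod>c\<in>Basis. (?r u - ?r l) \<bullet> c) = (\<Prod>c\<in>Basis. (u - l) \<bullet> c)"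
  proof -
    have p: "(\<Prod>c\<in>Basis. z \<bullet> c) = (\<Prod>i\<in>UNIV. z $ i)" for z :: "real^'x::finite"
    proof -
      have "(Basis :: (real^'x) set) = range (\<lambda>i. axis i 1)"
        by (auto simp: Basis_vec_def)
      then have "(\<Prod>c\<in>Basis. z \<bullet> c) = (\<Prod>c\<in>range (\<lambda>i. axis i 1). z \<bullet> c)"
        by (rule arg_cong)
      also have "\<dots> = (\<Prod>i\<in>UNIV. z \<bullet> axis i 1)"
        by (subst prod.reindex) (auto simp: inj_def axis_eq_axis)
      finally show ?thesis
        by (simp add: inner_axis)
    qed
    show ?thesis
      unfolding p
      using prod.reindex_bij_betw[OF bij_betw_inv_into[OF assms], of "\<lambda>i. (u - l) $ i"] by simp
  qed
  finally show "emeasure (distr lborel borel (permute_coords b)) (box l u) = (\<Prod>c\<in>Basis. (u - l) \<bullet> c)" .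
qed simp

text \<open>The two index types differ, so the Leibniz sums are compared directly: transporting
  permutations along \<open>b\<close> is a bijection that preserves signs and the products of
  entries.\<close>

lemma det_permute_coords:
  fixes b :: "'k::finite \<Rightarrow> 'm::finite" and G :: "real^'m^'m"
  assumes b: "bij b"
  shows "det (\<chi> i j. G $ b i $ b j) = det G"
proof -
  have bb: "bij_betw b UNIV UNIV" using b by simp
  have "det (\<chi> i j. G $ b i $ b j) =
    (\<Sum>p\<in>{p. p permutes (UNIV :: 'k set)}. of_int (sign (map_permutation UNIV b p)) * (\<Prod>i\<in>UNIV. G $ i $ map_permutation UNIV b p i))"
    unfolding det_def
  proof (intro sum.cong refl)
    fix p :: "'k \<Rightarrow> 'k" assume "p \<in> {p. p permutes UNIV}"
    then have p: "p permutes UNIV" by simp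
    have "(\<Prod>i\<in>UNIV. G $ i $ map_permutation UNIV b p i) = (\<Prod>i\<in>UNIV. G $ b i $ map_permutation UNIV b p (b i))"
      by (rule prod.reindex_bij_betw[OF bb, symmetric])
    also have "\<dots> = (\<Prod>i\<in>UNIV. G $ b i $ b (p i))"
      using b by (simp add: map_permutation_def restrict_id_def bij_is_inj)
    finally show "of_int (sign p) * (\<Prod>i\<in>UNIV. (\<chi> i j. G $ b i $ b j) $ i $ p i) =
      of_int (sign (map_permutation UNIV b p)) * (\<Prod>i\<in>UNIV. G $ i $ map_permutation UNIV b p i)"
      using sign_map_permutation[OF bij_is_inj[OF b] p] by simp
  qed
  also have "\<dots> = det G"
  proof -
    have "bij_betw (map_permutation UNIV b) {p. p permutes UNIV} {p. p permutes UNIV}"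
    proof -
      have "map_permutation UNIV b = (\<lambda>p x. b (p (inv b x)))"
        using b by (simp add: fun_eq_iff map_permutation_def restrict_id_def bij_is_surj)
      then show ?thesis
        using bij_betw_permutations[OF bb] by simp
    qed
    then show ?thesis
      unfolding det_def
      by (rule sum.reindex_bij_betw[of _ _ _ "\<lambda>p. of_int (sign p) * (\<Prod>i\<in>UNIV. G $ i $ p i)"])
  qed
  finally show ?thesis .
qed

lemma borel_measurable_gram_density:
  assumes "E \<in> sets borel" "continuous_on E A"
  shows "(\<lambda>x. ennreal (gram_density (A x)) * indicator E x) \<in> borel_measurable borel"
proof -
  have "(\<lambda>x. indicat_real E x *\<^sub>R gram_density (A x)) \<in> borel_measurable borel"
    using assms by (intro borel_measurable_continuous_on_indicator continuous_on_gram_density)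
  then have "(\<lambda>x. ennreal (indicat_real E x *\<^sub>R gram_density (A x))) \<in> borel_measurable borel"
    by simp
  also have "(\<lambda>x. ennreal (indicat_real E x *\<^sub>R gram_density (A x))) = (\<lambda>x. ennreal (gram_density (A x)) * indicator E x)"
    by (auto simp: fun_eq_iff indicator_def)
  finally show ?thesis .
qed

text \<open>Both charts are precomposed with the coordinate relabelling \<open>q\<close>. It
  preserves Lebesgue measure and permutes rows and columns of the Gram matrix simultaneously, so
  neither integral changes.\<close>

lemma chart_area_eq:
  fixes \<phi> \<psi> :: "real^'m \<Rightarrow> real^'n"
  assumes d\<phi>: "\<And>x. x \<in> E \<Longrightarrow> (\<phi> has_derivative (*v) (A x)) (at x)"
    and contA: "continuous_on E A" and inj\<phi>: "inj_on \<phi> E"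
    and d\<psi>: "\<And>y. y \<in> F \<Longrightarrow> (\<psi> has_derivative (*v) (C y)) (at y)"
    and contC: "continuous_on F C" and injC: "\<And>y. y \<in> F \<Longrightarrow> inj ((*v) (C y))"
    and g: "\<And>y. y \<in> F \<Longrightarrow> g (\<psi> y) = y" "continuous_on (\<psi> ` F) g"
    and E: "E \<in> sets borel" and F: "F \<in> sets borel" and EF: "\<phi> ` E = \<psi> ` F"
  shows "(\<integral>\<^sup>+x\<in>E. ennreal (gram_density (A x)) \<partial>lborel) = (\<integral>\<^sup>+y\<in>F. ennreal (gram_density (C y)) \<partial>lborel)"
proof -
  obtain b :: "'m idx \<Rightarrow> 'm" where b: "bij b" using ex_bij_idx by blast
  define p :: "real^'m \<Rightarrow> real^'m idx" where "p = permute_coords b"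
  define q :: "real^'m idx \<Rightarrow> real^'m" where "q = permute_coords (inv b)"
  have qp: "q (p x) = x" and pq: "p (q y) = y" for x y
    using permute_coords_inv[OF b] by (simp_all add: p_def q_def)
  have lin: "bounded_linear p" "bounded_linear q"
    by (simp_all add: p_def q_def linear_permute_coords linear_conv_bounded_linear[symmetric])
  have cont: "continuous_on X p" "continuous_on Y q" for X Y
    using lin by (simp_all add: linear_continuous_on)
  have qm: "q \<in> borel_measurable borel" 
    using cont(2) by (rule borel_measurable_continuous_onI)
  \<comment> \<open>Reading images under \<open>p\<close> as preimages under \<open>q\<close> makes
    them Borel by measurability of \<open>q\<close>.\<close>
  have qv: "q -` X = p ` X" for X
  proof
    show "q -` X \<subseteq> p ` X"
      using pq by (metis imageI subsetI vimageE)
  qed (auto simp: qp)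
  \<comment> \<open>\<open>K A y\<close> has the columns of \<open>A (q y)\<close> relabelled by
    \<open>b\<close>; it is the Jacobian matrix at \<open>y\<close> of \<open>f \<circ> q\<close>
    when \<open>A\<close> is that of \<open>f\<close>.\<close>
  define K where "K A y = (\<chi> i j. A (q y) $ i $ b j)" for A :: "real^'m \<Rightarrow> real^'m^'n" and y
  have KK: "(*v) (K A y) = (*v) (A (q y)) \<circ> q" for A y
  proof -
    have "(\<Sum>j\<in>UNIV. A (q y) $ i $ b j * v $ j) = (\<Sum>j\<in>UNIV. A (q y) $ i $ j * v $ inv b j)" for i v
      using sum.reindex_bij_betw[OF b, of "\<lambda>j. A (q y) $ i $ j * v $ inv b j"] b
      by (simp add: bij_is_inj)
    then show ?thesis
      by (simp add: fun_eq_iff vec_eq_iff matrix_vector_mult_def K_def q_def)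
  qed
  have Kgram: "gram_density (K A y) = gram_density (A (q y))" for A y
  proof -
    have "transpose (K A y) ** K A y = (\<chi> i j. (transpose (A (q y)) ** A (q y)) $ b i $ b j)"
      by (simp add: vec_eq_iff matrix_matrix_mult_def transpose_def K_def)
    then show ?thesis
      using det_permute_coords[OF b] by (simp add: gram_density_def)
  qed
  have Kcont: "continuous_on (p ` X) (K A)" if "continuous_on X A" for X A
  proof -
    have "continuous_on (p ` X) (\<lambda>y. A (q y))"
      using that by (rule continuous_on_compose2[OF _ cont(2)]) (auto simp: qp)
    then show ?thesis
      unfolding K_def by (intro continuous_intros)
  qed
  have Kder: "(f \<circ> q has_derivative (*v) (K A y)) (at y)"
    if "(f has_derivative (*v) (A (q y))) (at (q y))" for f :: "real^'m \<Rightarrow> real^'n" and A y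
    unfolding KK
    by (rule diff_chain_at[OF bounded_linear_imp_has_derivative[OF lin(2)] that])
  have int: "(\<integral>\<^sup>+y\<in>p ` X. ennreal (gram_density (K A y)) \<partial>lborel) = (\<integral>\<^sup>+x\<in>X. ennreal (gram_density (A x)) \<partial>lborel)"
    if "X \<in> sets borel" "continuous_on X A" for X A
  proof -
    have "bij (inv b)" using b by (simp add: bij_imp_bij_inv)
    then have "(\<integral>\<^sup>+x\<in>X. ennreal (gram_density (A x)) \<partial>lborel) =
        (\<integral>\<^sup>+x\<in>X. ennreal (gram_density (A x)) \<partial>distr lborel borel q)"
      unfolding q_def by (simp add: lborel_distr_permute_coords)
    also have "\<dots> = (\<integral>\<^sup>+y. ennreal (gram_density (A (q y))) * indicator X (q y) \<partial>lborel)"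
      using qm borel_measurable_gram_density[OF that] by (subst nn_integral_distr) auto
    also have "\<dots> = (\<integral>\<^sup>+y\<in>p ` X. ennreal (gram_density (K A y)) \<partial>lborel)"
      by (intro nn_integral_cong) (auto simp: Kgram indicator_def qp pq simp flip: qv)
    finally show ?thesis ..
  qed
  have "(\<integral>\<^sup>+y\<in>p ` E. ennreal (gram_density (K A y)) \<partial>lborel) = (\<integral>\<^sup>+y\<in>p ` F. ennreal (gram_density (K C y)) \<partial>lborel)"
  proof (rule chart_area_eq_wellorder[where \<phi> = "\<phi> \<circ> q" and \<psi> = "\<psi> \<circ> q" and g = "p \<circ> g"])
    show "((\<phi> \<circ> q) has_derivative (*v) (K A y)) (at y)" if "y \<in> p ` E" for y
      using that by (intro Kder d\<phi>) (auto simp: qp)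
    show "((\<psi> \<circ> q) has_derivative (*v) (K C y)) (at y)" if "y \<in> p ` F" for y
      using that by (intro Kder d\<psi>) (auto simp: qp)
    show "inj_on (\<phi> \<circ> q) (p ` E)"
      using inj\<phi> by (auto simp: inj_on_def qp)
    show "inj ((*v) (K C y))" if "y \<in> p ` F" for y
    proof -
      have "inj q" using pq by (metis injI)
      moreover have "inj ((*v) (C (q y)))" using that by (auto simp: qp intro!: injC)
      ultimately show ?thesis unfolding KK by (rule inj_compose[rotated])
    qed
    show "continuous_on ((\<psi> \<circ> q) ` p ` F) (p \<circ> g)"
      using g(2) by (intro continuous_on_compose cont) (simp add: image_image qp)
    show "(\<phi> \<circ> q) ` p ` E = (\<psi> \<circ> q) ` p ` F"
      by (simp add: image_image qp EF)
    show "p ` E \<in> sets borel" "p ` F \<in> sets borel"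
      using measurable_sets_borel[OF qm E] measurable_sets_borel[OF qm F] by (simp_all add: qv)
  qed (use contA contC g(1) in \<open>auto simp: qp intro!: Kcont\<close>)
  then show ?thesis
    by (simp add: int E F contA contC)
qed

section \<open>Basic properties of local parametrizations\<close>

lemma local_parametrizationD:
  assumes "local_parametrization M U \<phi>"
  shows "open U" and "continuous_on U (\<lambda>x. jacobian \<phi> (at x))"
    and "openin (top_of_set M) (\<phi> ` U)" and "\<exists>\<psi>. homeomorphism U (\<phi> ` U) \<phi> \<psi>"
    and "\<And>x. x \<in> U \<Longrightarrow> (\<phi> has_derivative (*v) (jacobian \<phi> (at x))) (at x)"
  using assms by (auto simp: local_parametrization_def simp flip: jacobian_works)

lemma local_parametrization_inj_jacobian:
  assumes "local_parametrization M U \<phi>" "x \<in> U"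
  shows "inj ((*v) (jacobian \<phi> (at x)))"
  using frechet_derivative_at[OF local_parametrizationD(5)[OF assms]] assms
  by (simp add: local_parametrization_def)

section \<open>The volume measure of a submanifold\<close>

text \<open>The open set \<open>U\<close> is a countable union of compact sets, hence so is its
  image, which is therefore Borel. Within that image the image of \<open>E\<close> is the preimage
  of \<open>E\<close> under the continuous inverse.\<close>

lemma borel_image_homeomorphism_open:
  fixes \<phi> :: "real^'m \<Rightarrow> real^'n"
  assumes U: "open U" and hom: "homeomorphism U (\<phi> ` U) \<phi> \<psi>" and E: "E \<in> sets borel" "E \<subseteq> U"
  shows "\<phi> ` E \<in> sets borel"
proof -
  obtain F :: "nat \<Rightarrow> _" where F: "\<And>i. compact (F i)" "(\<Union>i. F i) = U"
    using open_Union_compact_subsets[OF U] by metis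
  have "\<phi> ` F i \<in> sets borel" for i
  proof -
    have "continuous_on (F i) \<phi>"
      using hom F(2) by (auto simp: homeomorphism_def intro: continuous_on_subset)
    then have "compact (\<phi> ` F i)" using F(1) by (intro compact_continuous_image)
    then show ?thesis by (simp add: borel_compact)
  qed
  then have im: "\<phi> ` U \<in> sets borel"
    unfolding F(2)[symmetric] by (simp add: image_UN)
  have "\<psi> \<in> borel_measurable (restrict_space borel (\<phi> ` U))"
    using hom by (intro borel_measurable_continuous_on_restrict) (simp add: homeomorphism_def)
  then have "\<psi> -` E \<inter> space (restrict_space borel (\<phi> ` U)) \<in> sets (restrict_space borel (\<phi> ` U))"
    using E(1) by (rule measurable_sets)
  then have "\<psi> -` E \<inter> \<phi> ` U \<in> sets borel"
    using im by (simp add: space_restrict_space sets_restrict_space_iff)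
  also have "\<psi> -` E \<inter> \<phi> ` U = \<phi> ` E"
    using hom E(2) by (force simp: homeomorphism_def)
  finally show ?thesis .
qed

lemma borel_preimage_continuous_on_open:
  fixes \<phi> :: "real^'m \<Rightarrow> real^'n"
  assumes U: "open U" and c: "continuous_on U \<phi>" and B: "B \<in> sets borel"
  shows "{x \<in> U. \<phi> x \<in> B} \<in> sets borel"
proof -
  have "\<phi> -` B \<inter> space (restrict_space borel U) \<in> sets (restrict_space borel U)"
    using borel_measurable_continuous_on_restrict[OF c] B by (rule measurable_sets)
  moreover have "\<phi> -` B \<inter> space (restrict_space borel U) = {x \<in> U. \<phi> x \<in> B}"
    by (auto simp: space_restrict_space)
  ultimately show ?thesis
    using U by (simp add: sets_restrict_space_iff)
qed

section \<open>The area measure of a single chart\<close>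

definition chart_measure :: "(real^'m) set \<Rightarrow> (real^'m \<Rightarrow> real^'n) \<Rightarrow> (real^'n) measure" where
  "chart_measure U \<phi> =
     distr (density lborel (\<lambda>x. ennreal (gram_density (jacobian \<phi> (at x))) * indicator U x)) borel
       (\<lambda>x. if x \<in> U then \<phi> x else 0)"

lemma sets_chart_measure [simp, measurable_cong]: "sets (chart_measure U \<phi>) = sets borel"
  by (simp add: chart_measure_def)

lemma emeasure_chart_measure:
  fixes \<phi> :: "real^'m \<Rightarrow> real^'n"
  assumes \<phi>: "local_parametrization M U \<phi>" and B: "B \<in> sets borel"
  shows "emeasure (chart_measure U \<phi>) B =
    (\<integral>\<^sup>+x\<in>{x \<in> U. \<phi> x \<in> B}. ennreal (gram_density (jacobian \<phi> (at x))) \<partial>lborel)"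
proof -
  obtain \<psi> where f: "open U" "continuous_on U (\<lambda>x. jacobian \<phi> (at x))" "homeomorphism U (\<phi> ` U) \<phi> \<psi>"
    using local_parametrizationD[OF \<phi>] by blast
  have d: "(\<lambda>x. ennreal (gram_density (jacobian \<phi> (at x))) * indicator U x) \<in> borel_measurable borel"
    using f by (intro borel_measurable_gram_density) auto
  have m: "(\<lambda>x. if x \<in> U then \<phi> x else 0) \<in> borel_measurable borel"
    using f by (intro borel_measurable_continuous_on_if) (auto simp: homeomorphism_def)
  have "emeasure (chart_measure U \<phi>) B =
     emeasure (density lborel (\<lambda>x. ennreal (gram_density (jacobian \<phi> (at x))) * indicator U x))
      ((\<lambda>x. if x \<in> U then \<phi> x else 0) -` B)"
    unfolding chart_measure_def using m B by (subst emeasure_distr) auto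
  \<comment> \<open>If \<open>0 \<in> B\<close>, the preimage also contains the whole complement of
    \<open>U\<close>, because of the default value 0. The density vanishes there, so no mass is
    added.\<close>
  also have "\<dots> = (\<integral>\<^sup>+x\<in>{x \<in> U. \<phi> x \<in> B}. ennreal (gram_density (jacobian \<phi> (at x))) \<partial>lborel)"
    using d measurable_sets_borel[OF m B]
    by (subst emeasure_density) (auto intro!: nn_integral_cong simp: indicator_def)
  finally show ?thesis .
qed

text \<open>The charts may belong to different submanifolds \<open>M\<close> and \<open>M'\<close>.
  Both are restricted to the preimages of \<open>B\<close>, and the inverse homeomorphism of
  \<open>\<psi>\<close> serves as the continuous left inverse in
  \<open>chart_area_eq\<close>.\<close>

lemma emeasure_chart_measure_eq:
  fixes \<phi> \<psi> :: "real^'m \<Rightarrow> real^'n"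
  assumes \<phi>: "local_parametrization M U \<phi>" and \<psi>: "local_parametrization M' V \<psi>"
    and B: "B \<in> sets borel" "B \<subseteq> \<phi> ` U" "B \<subseteq> \<psi> ` V"
  shows "emeasure (chart_measure U \<phi>) B = emeasure (chart_measure V \<psi>) B"
proof -
  note f = local_parametrizationD[OF \<phi>] and g = local_parametrizationD[OF \<psi>]
  obtain \<phi>' where \<phi>': "homeomorphism U (\<phi> ` U) \<phi> \<phi>'" using f(4) by blast
  obtain \<psi>' where \<psi>': "homeomorphism V (\<psi> ` V) \<psi> \<psi>'" using g(4) by blast
  show ?thesis
    unfolding emeasure_chart_measure[OF \<phi> B(1)] emeasure_chart_measure[OF \<psi> B(1)]
  proof (rule chart_area_eq[where \<phi> = \<phi> and \<psi> = \<psi> and g = \<psi>'])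
    show "continuous_on {x \<in> U. \<phi> x \<in> B} (\<lambda>x. jacobian \<phi> (at x))"
      using f(2) by (rule continuous_on_subset) auto
    show "continuous_on {x \<in> V. \<psi> x \<in> B} (\<lambda>x. jacobian \<psi> (at x))"
      using g(2) by (rule continuous_on_subset) auto
    show "inj_on \<phi> {x \<in> U. \<phi> x \<in> B}"
      using \<phi>' by (auto simp: homeomorphism_def intro!: inj_on_inverseI[of _ \<phi>'])
    have im: "\<phi> ` {x \<in> U. \<phi> x \<in> B} = B" "\<psi> ` {x \<in> V. \<psi> x \<in> B} = B"
      using B by auto
    then show "\<phi> ` {x \<in> U. \<phi> x \<in> B} = \<psi> ` {x \<in> V. \<psi> x \<in> B}" by simp
    show "continuous_on (\<psi> ` {x \<in> V. \<psi> x \<in> B}) \<psi>'"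
      unfolding im using \<psi>' B(3) by (auto simp: homeomorphism_def intro: continuous_on_subset)
    show "\<psi>' (\<psi> y) = y" if "y \<in> {x \<in> V. \<psi> x \<in> B}" for y
      using that \<psi>' by (simp add: homeomorphism_def)
    show "{x \<in> U. \<phi> x \<in> B} \<in> sets borel" "{x \<in> V. \<psi> x \<in> B} \<in> sets borel"
      using f(1) g(1) \<phi>' \<psi>' B by (auto intro!: borel_preimage_continuous_on_open simp: homeomorphism_def)
  qed (use f(5) g(5) local_parametrization_inj_jacobian[OF \<psi>] in auto)
qed

lemma local_parametrization_image_borel:
  fixes \<phi> :: "real^'m \<Rightarrow> real^'n"
  assumes "local_parametrization M U \<phi>" "E \<in> sets borel" "E \<subseteq> U"
  shows "\<phi> ` E \<in> sets borel"
proof -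
  obtain \<psi> where "homeomorphism U (\<phi> ` U) \<phi> \<psi>"
    using local_parametrizationD(4)[OF assms(1)] by blast
  then show ?thesis
    using borel_image_homeomorphism_open[OF local_parametrizationD(1)[OF assms(1)]] assms(2,3) by blast
qed

section \<open>Countable atlases and the measure glued from their charts\<close>

definition is_atlas :: "(real^'n) set \<Rightarrow> (nat \<Rightarrow> (real^'m) set) \<Rightarrow> (nat \<Rightarrow> real^'m \<Rightarrow> real^'n) \<Rightarrow> bool" where
  "is_atlas S U \<phi> \<longleftrightarrow> (\<forall>i. local_parametrization S (U i) (\<phi> i)) \<and> (\<Union>i. \<phi> i ` U i) = S"

text \<open>Chart images are relatively open and cover \<open>S\<close>, so by the Lindelof property
  countably many of them suffice.\<close>

lemma submanifold_atlas:
  fixes S :: "(real^'n) set"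
  assumes "submanifold TYPE('m::finite) S"
  obtains U :: "nat \<Rightarrow> (real^'m) set" and \<phi> where "is_atlas S U \<phi>"
proof -
  define \<F> where "\<F> = {\<phi> ` U |\<phi> (U :: (real^'m) set). local_parametrization S U \<phi>}"
  have "openin (top_of_set S) W" if "W \<in> \<F>" for W
    using that by (auto simp: \<F>_def local_parametrization_def)
  then obtain \<F>' where \<F>': "\<F>' \<subseteq> \<F>" "countable \<F>'" "\<Union>\<F>' = \<Union>\<F>"
    using Lindelof_openin by metis
  \<comment> \<open>The empty chart makes the countable family nonempty, so that it can be
    enumerated by all natural numbers even if \<open>S\<close> is empty.\<close>
  have empty: "local_parametrization S {} (\<lambda>_ :: real^'m. 0)"
    by (simp add: local_parametrization_def homeomorphism_def)
  define c where "c = from_nat_into (insert {} \<F>')"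
  have range_c: "range c = insert {} \<F>'"
    unfolding c_def using \<F>'(2) by (intro range_from_nat_into) auto
  have "{} \<in> \<F>"
    unfolding \<F>_def using empty by force
  then have "insert {} \<F>' \<subseteq> \<F>"
    using \<F>'(1) by (rule insert_subsetI)
  then have c: "c i \<in> \<F>" for i
    using range_c rangeI[of c i] by (metis subsetD)
  have "\<exists>W \<phi>. local_parametrization S (W :: (real^'m) set) \<phi> \<and> c i = \<phi> ` W" for i
    using c[of i] unfolding \<F>_def by blast
  then obtain U :: "nat \<Rightarrow> (real^'m) set" and \<phi>
    where p: "\<And>i. local_parametrization S (U i) (\<phi> i)" "\<And>i. c i = \<phi> i ` U i"
    by metis
  have "\<Union>\<F> = S"
  proof
    show "\<Union>\<F> \<subseteq> S"
      using local_parametrizationD(3) by (force simp: \<F>_def openin_open)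
    show "S \<subseteq> \<Union>\<F>"
    proof
      fix x assume "x \<in> S"
      then obtain W and \<phi> :: "real^'m \<Rightarrow> real^'n" where "local_parametrization S W \<phi>" "x \<in> \<phi> ` W"
        using assms by (auto simp: submanifold_def)
      then show "x \<in> \<Union>\<F>"
        unfolding \<F>_def by blast
    qed
  qed
  then have "(\<Union>i. c i) = S"
    using range_c \<F>'(3) by auto
  then have "is_atlas S U \<phi>"
    using p by (simp add: is_atlas_def)
  then show thesis by (rule that)
qed

lemma submanifold_borel:
  fixes S :: "(real^'n) set"
  assumes "submanifold TYPE('m::finite) S"
  shows "S \<in> sets borel"
proof -
  obtain U :: "nat \<Rightarrow> (real^'m) set" and \<phi> where A: "is_atlas S U \<phi>"
    using submanifold_atlas[OF assms] .
  have "\<phi> i ` U i \<in> sets borel" for i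
    using A
    by (intro local_parametrization_image_borel[of S "U i"]) (auto simp: is_atlas_def local_parametrization_def)
  then have "(\<Union>i. \<phi> i ` U i) \<in> sets borel" by blast
  then show ?thesis using A by (simp add: is_atlas_def)
qed

text \<open>Chart images overlap; intersecting with their disjointed versions counts every point of
  the submanifold exactly once. The measure lives on all Borel sets of the ambient space, which
  makes measures of different atlases comparable.\<close>

definition atlas_measure :: "(nat \<Rightarrow> (real^'m) set) \<Rightarrow> (nat \<Rightarrow> real^'m \<Rightarrow> real^'n) \<Rightarrow> (real^'n) measure" where
  "atlas_measure U \<phi> = measure_of UNIV (sets borel)
     (\<lambda>B. \<Sum>i. emeasure (chart_measure (U i) (\<phi> i)) (B \<inter> disjointed (\<lambda>i. \<phi> i ` U i) i))"

lemma sets_atlas_measure [simp, measurable_cong]: "sets (atlas_measure U \<phi>) = sets borel"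
  by (simp add: atlas_measure_def sets_measure_of_conv) (metis sets.sigma_sets_eq space_borel)

text \<open>Tonelli's theorem for counting measure, needed for the countable additivity of
  \<open>atlas_measure\<close>.\<close>

lemma ennreal_suminf_swap:
  fixes f :: "nat \<Rightarrow> nat \<Rightarrow> ennreal"
  shows "(\<Sum>i. \<Sum>k. f i k) = (\<Sum>k. \<Sum>i. f i k)"
proof -
  have "(\<integral>\<^sup>+i. (\<Sum>k. f i k) \<partial>count_space UNIV) = (\<Sum>k. \<integral>\<^sup>+i. f i k \<partial>count_space UNIV)"
    by (rule nn_integral_suminf) simp
  then show ?thesis by (simp add: nn_integral_count_space_nat)
qed

lemma atlas_disjointed_borel:
  fixes U :: "nat \<Rightarrow> (real^'m) set" and S :: "(real^'n) set"
  assumes "is_atlas S U \<phi>"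
  shows "disjointed (\<lambda>i. \<phi> i ` U i) i \<in> sets borel"
proof -
  have "\<phi> i ` U i \<in> sets borel" for i
    using assms
    by (intro local_parametrization_image_borel[of S "U i"]) (auto simp: is_atlas_def local_parametrization_def)
  then have "range (disjointed (\<lambda>i. \<phi> i ` U i)) \<subseteq> sets borel"
    by (intro sets.range_disjointed_sets) auto
  then show ?thesis by auto
qed

lemma emeasure_atlas_measure:
  fixes U :: "nat \<Rightarrow> (real^'m) set" and S :: "(real^'n) set"
  assumes A: "is_atlas S U \<phi>" and B: "B \<in> sets borel"
  shows "emeasure (atlas_measure U \<phi>) B =
    (\<Sum>i. emeasure (chart_measure (U i) (\<phi> i)) (B \<inter> disjointed (\<lambda>i. \<phi> i ` U i) i))"
proof -
  let ?D = "disjointed (\<lambda>i. \<phi> i ` U i)"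
  show ?thesis
  proof (rule emeasure_measure_of[OF atlas_measure_def])
    show "positive (sets (atlas_measure U \<phi>)) (\<lambda>B. \<Sum>i. emeasure (chart_measure (U i) (\<phi> i)) (B \<inter> ?D i))"
      by (simp add: positive_def)
    show "countably_additive (sets (atlas_measure U \<phi>)) (\<lambda>B. \<Sum>i. emeasure (chart_measure (U i) (\<phi> i)) (B \<inter> ?D i))"
    proof (rule countably_additiveI)
      fix F :: "nat \<Rightarrow> (real^'n) set"
      assume F: "range F \<subseteq> sets (atlas_measure U \<phi>)" "disjoint_family F"
      have "(\<Sum>k. emeasure (chart_measure (U i) (\<phi> i)) (F k \<inter> ?D i)) =
            emeasure (chart_measure (U i) (\<phi> i)) ((\<Union>k. F k) \<inter> ?D i)" for i
      proof -
        have "(\<Sum>k. emeasure (chart_measure (U i) (\<phi> i)) (F k \<inter> ?D i)) =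
              emeasure (chart_measure (U i) (\<phi> i)) (\<Union>k. F k \<inter> ?D i)"
          using F atlas_disjointed_borel[OF A, of i]
          by (intro suminf_emeasure) (auto simp: disjoint_family_on_def)
        then show ?thesis by (simp add: Int_commute)
      qed
      then show "(\<Sum>k. \<Sum>i. emeasure (chart_measure (U i) (\<phi> i)) (F k \<inter> ?D i)) =
            (\<Sum>i. emeasure (chart_measure (U i) (\<phi> i)) (\<Union>(range F) \<inter> ?D i))"
        by (subst ennreal_suminf_swap) simp
    qed
  qed (use B in auto)
qed

text \<open>\<open>B\<close> is cut along the disjointed chart images, and each part is measured
  equally by its atlas chart and by \<open>\<psi>\<close>. As \<open>\<psi>\<close> may parametrize
  another submanifold \<open>M\<close>, this also prepares the agreement on overlaps.\<close>

lemma emeasure_atlas_measure_chart: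
  fixes U :: "nat \<Rightarrow> (real^'m) set" and S :: "(real^'n) set"
  assumes A: "is_atlas S U \<phi>" and V: "local_parametrization M (V :: (real^'m) set) \<psi>"
    and B: "B \<in> sets borel" "B \<subseteq> S" "B \<subseteq> \<psi> ` V"
  shows "emeasure (atlas_measure U \<phi>) B = emeasure (chart_measure V \<psi>) B"
proof -
  let ?D = "disjointed (\<lambda>i. \<phi> i ` U i)"
  have "emeasure (chart_measure (U i) (\<phi> i)) (B \<inter> ?D i) = emeasure (chart_measure V \<psi>) (B \<inter> ?D i)" for i
    using A V B atlas_disjointed_borel[OF A, of i] disjointed_subset[of "\<lambda>i. \<phi> i ` U i" i]
    by (intro emeasure_chart_measure_eq[where M = S and M' = M]) (auto simp: is_atlas_def)
  then have "emeasure (atlas_measure U \<phi>) B = (\<Sum>i. emeasure (chart_measure V \<psi>) (B \<inter> ?D i))"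
    by (simp add: emeasure_atlas_measure[OF A B(1)])
  also have "\<dots> = emeasure (chart_measure V \<psi>) (\<Union>i. B \<inter> ?D i)"
    using B(1) atlas_disjointed_borel[OF A] disjoint_family_disjointed[of "\<lambda>i. \<phi> i ` U i"]
    by (intro suminf_emeasure) (auto simp: disjoint_family_on_def)
  also have "(\<Union>i. B \<inter> ?D i) = B"
    using B(2) A by (auto simp: is_atlas_def UN_disjointed_eq simp flip: Int_UN_distrib)
  finally show ?thesis .
qed

text \<open>Uniqueness: every Borel subset of \<open>S\<close> is a countable disjoint union of
  images of Borel sets under atlas charts, and on these images the value of \<open>\<mu>\<close> is
  prescribed.\<close>

lemma emeasure_eq_atlas_cover:
  fixes U :: "nat \<Rightarrow> (real^'m) set" and S :: "(real^'n) set"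
  assumes A: "is_atlas S U \<phi>" and s: "sets \<mu> = sets (restrict_space borel S)"
    and eq: "\<And>i E. E \<in> sets borel \<Longrightarrow> E \<subseteq> U i \<Longrightarrow> emeasure \<mu> (\<phi> i ` E) =
      (\<integral>\<^sup>+x\<in>E. ennreal (gram_density (jacobian (\<phi> i) (at x))) \<partial>lborel)"
    and B: "B \<in> sets borel" "B \<subseteq> S"
  shows "emeasure \<mu> B = emeasure (atlas_measure U \<phi>) B"
proof -
  let ?D = "disjointed (\<lambda>i. \<phi> i ` U i)"
  have S: "(\<Union>i. ?D i) = S" using A by (simp add: is_atlas_def UN_disjointed_eq)
  have "emeasure \<mu> (B \<inter> ?D i) = emeasure (chart_measure (U i) (\<phi> i)) (B \<inter> ?D i)" for i
  proof -
    have U: "local_parametrization S (U i) (\<phi> i)" using A by (simp add: is_atlas_def)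
    have BD: "B \<inter> ?D i \<in> sets borel" using B(1) atlas_disjointed_borel[OF A] by blast
    obtain \<psi> where "open (U i)" "homeomorphism (U i) (\<phi> i ` U i) (\<phi> i) \<psi>"
      using local_parametrizationD[OF U] by blast
    then have "{x \<in> U i. \<phi> i x \<in> B \<inter> ?D i} \<in> sets borel"
      using BD by (intro borel_preimage_continuous_on_open) (auto simp: homeomorphism_def)
    then have "emeasure \<mu> (\<phi> i ` {x \<in> U i. \<phi> i x \<in> B \<inter> ?D i}) = emeasure (chart_measure (U i) (\<phi> i)) (B \<inter> ?D i)"
      by (subst eq) (auto simp: emeasure_chart_measure[OF U BD])
    also have "\<phi> i ` {x \<in> U i. \<phi> i x \<in> B \<inter> ?D i} = B \<inter> ?D i"
      using disjointed_subset[of "\<lambda>i. \<phi> i ` U i" i] by auto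
    finally show ?thesis .
  qed
  then have "emeasure (atlas_measure U \<phi>) B = (\<Sum>i. emeasure \<mu> (B \<inter> ?D i))"
    by (simp add: emeasure_atlas_measure[OF A B(1)])
  also have "\<dots> = emeasure \<mu> (\<Union>i. B \<inter> ?D i)"
  proof (rule suminf_emeasure)
    show "range (\<lambda>i. B \<inter> ?D i) \<subseteq> sets \<mu>"
    proof safe
      fix i
      have "B \<inter> ?D i \<in> sets borel" "B \<inter> ?D i \<subseteq> S"
        using B atlas_disjointed_borel[OF A, of i] by auto
      then show "B \<inter> ?D i \<in> sets \<mu>"
        unfolding s sets_restrict_space by (intro image_eqI[of _ _ "B \<inter> ?D i"]) blast
    qed
    show "disjoint_family (\<lambda>i. B \<inter> ?D i)"
      using disjoint_family_disjointed[of "\<lambda>i. \<phi> i ` U i"] by (auto simp: disjoint_family_on_def)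
  qed
  also have "(\<Union>i. B \<inter> ?D i) = B"
    using B(2) S by (auto simp flip: Int_UN_distrib)
  finally show ?thesis ..
qed

section \<open>Existence, uniqueness and overlap agreement of volume measures\<close>

lemma is_volume_measure_atlas:
  fixes U :: "nat \<Rightarrow> (real^'m) set" and S :: "(real^'n) set"
  assumes "submanifold TYPE('m::finite) S" and A: "is_atlas S U \<phi>"
  shows "is_volume_measure TYPE('m) S (restrict_space (atlas_measure U \<phi>) S)"
  unfolding is_volume_measure_def
proof (intro conjI allI impI)
  have S: "S \<in> sets borel" using assms(1) by (rule submanifold_borel)
  show "sets (restrict_space (atlas_measure U \<phi>) S) = sets (restrict_space borel S)"
    by (rule sets_restrict_space_cong) simp
  fix V :: "(real^'m) set" and \<psi> E
  assume V: "local_parametrization S V \<psi>" and E: "E \<in> sets borel" "E \<subseteq> V"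
  obtain \<psi>' where g: "openin (top_of_set S) (\<psi> ` V)" "homeomorphism V (\<psi> ` V) \<psi> \<psi>'"
    using local_parametrizationD[OF V] by blast
  have sub: "\<psi> ` E \<subseteq> S" using openin_subset[OF g(1)] E(2) by auto
  have b: "\<psi> ` E \<in> sets borel" using local_parametrization_image_borel[OF V E] .
  have "emeasure (restrict_space (atlas_measure U \<phi>) S) (\<psi> ` E) = emeasure (atlas_measure U \<phi>) (\<psi> ` E)"
    using sub S by (intro emeasure_restrict_space) auto
  \<comment> \<open>The defining formula is required for every parametrization of \<open>S\<close>,
    whether or not it occurs in the atlas.\<close>
  also have "\<dots> = emeasure (chart_measure V \<psi>) (\<psi> ` E)"
    using A V b sub E(2) by (intro emeasure_atlas_measure_chart) auto
  also have "\<dots> = (\<integral>\<^sup>+x\<in>{x \<in> V. \<psi> x \<in> \<psi> ` E}. ennreal (gram_density (jacobian \<psi> (at x))) \<partial>lborel)"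
    by (rule emeasure_chart_measure[OF V b])
  also have "{x \<in> V. \<psi> x \<in> \<psi> ` E} = E"
    using E(2) g(2) unfolding homeomorphism_def by (auto; metis subsetD)
  finally show "emeasure (restrict_space (atlas_measure U \<phi>) S) (\<psi> ` E) =
    (\<integral>\<^sup>+x\<in>E. ennreal (sqrt (det (transpose (jacobian \<psi> (at x)) ** jacobian \<psi> (at x)))) \<partial>lborel)"
    by (simp add: ennreal_gram_density)
qed

text \<open>Resolves the definite description in \<open>volume_measure\<close>: the preceding lemma
  gives existence, and \<open>emeasure_eq_atlas_cover\<close> gives uniqueness.\<close>

lemma volume_measure_atlas:
  fixes U :: "nat \<Rightarrow> (real^'m) set" and S :: "(real^'n) set"
  assumes S: "submanifold TYPE('m::finite) S" and A: "is_atlas S U \<phi>"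
  shows "volume_measure TYPE('m) S = restrict_space (atlas_measure U \<phi>) S"
  unfolding volume_measure_def
proof (rule the_equality)
  show v: "is_volume_measure TYPE('m) S (restrict_space (atlas_measure U \<phi>) S)"
    using S A by (rule is_volume_measure_atlas)
  fix \<mu> assume \<mu>: "is_volume_measure TYPE('m) S \<mu>"
  show "\<mu> = restrict_space (atlas_measure U \<phi>) S"
  proof (rule measure_eqI)
    show "sets \<mu> = sets (restrict_space (atlas_measure U \<phi>) S)"
      using \<mu> v by (simp add: is_volume_measure_def)
    fix B assume "B \<in> sets \<mu>"
    then have B: "B \<in> sets borel" "B \<subseteq> S"
      using \<mu> submanifold_borel[OF S] by (auto simp: is_volume_measure_def sets_restrict_space_iff)
    have "emeasure \<mu> B = emeasure (atlas_measure U \<phi>) B"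
    proof (rule emeasure_eq_atlas_cover[OF A _ _ B])
      show "sets \<mu> = sets (restrict_space borel S)"
        using \<mu> by (simp add: is_volume_measure_def)
      show "emeasure \<mu> (\<phi> i ` E) = (\<integral>\<^sup>+x\<in>E. ennreal (gram_density (jacobian (\<phi> i) (at x))) \<partial>lborel)"
        if "E \<in> sets borel" "E \<subseteq> U i" for i E
        using \<mu> A that unfolding is_volume_measure_def is_atlas_def ennreal_gram_density by blast
    qed
    also have "\<dots> = emeasure (restrict_space (atlas_measure U \<phi>) S) B"
      using B submanifold_borel[OF S] by (intro emeasure_restrict_space[symmetric]) auto
    finally show "emeasure \<mu> B = emeasure (restrict_space (atlas_measure U \<phi>) S) B" .
  qed
qed

lemma sets_volume_measure:
  assumes "submanifold TYPE('m::finite) S"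
  shows "sets (volume_measure TYPE('m) S) = sets (restrict_space borel S)"
  using submanifold_atlas[OF assms] volume_measure_atlas[OF assms]
  by (metis sets_atlas_measure sets_restrict_space_cong)

text \<open>\<open>B\<close> is split along an atlas of \<open>S\<close>; each part lies in one
  chart of \<open>S\<close> and also in \<open>S'\<close>, so the chart computes its measure in
  \<open>S'\<close> as well.\<close>

lemma emeasure_volume_measure_eq:
  fixes S S' :: "(real^'n) set"
  assumes S: "submanifold TYPE('m::finite) S" and S': "submanifold TYPE('m) S'"
    and B: "B \<in> sets borel" "B \<subseteq> S" "B \<subseteq> S'"
  shows "emeasure (volume_measure TYPE('m) S) B = emeasure (volume_measure TYPE('m) S') B"
proof -
  obtain U :: "nat \<Rightarrow> (real^'m) set" and \<phi> where A: "is_atlas S U \<phi>"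
    using submanifold_atlas[OF S] .
  obtain U' :: "nat \<Rightarrow> (real^'m) set" and \<phi>' where A': "is_atlas S' U' \<phi>'"
    using submanifold_atlas[OF S'] .
  let ?D = "disjointed (\<lambda>i. \<phi> i ` U i)"
  have "emeasure (chart_measure (U i) (\<phi> i)) (B \<inter> ?D i) = emeasure (atlas_measure U' \<phi>') (B \<inter> ?D i)" for i
    using A A' B atlas_disjointed_borel[OF A, of i] disjointed_subset[of "\<lambda>i. \<phi> i ` U i" i]
    by (intro emeasure_atlas_measure_chart[symmetric, where M = S and S = S']) (auto simp: is_atlas_def)
  then have "emeasure (atlas_measure U \<phi>) B = (\<Sum>i. emeasure (atlas_measure U' \<phi>') (B \<inter> ?D i))"
    by (simp add: emeasure_atlas_measure[OF A B(1)])
  also have "\<dots> = emeasure (atlas_measure U' \<phi>') (\<Union>i. B \<inter> ?D i)"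
    using B(1) atlas_disjointed_borel[OF A] disjoint_family_disjointed[of "\<lambda>i. \<phi> i ` U i"]
    by (intro suminf_emeasure) (auto simp: disjoint_family_on_def)
  also have "(\<Union>i. B \<inter> ?D i) = B"
    using B(2) A by (auto simp: is_atlas_def UN_disjointed_eq simp flip: Int_UN_distrib)
  finally show ?thesis
    using B submanifold_borel[OF S] submanifold_borel[OF S']
    by (simp add: volume_measure_atlas[OF S A] volume_measure_atlas[OF S' A'] emeasure_restrict_space)
qed

section \<open>The inductive volume measure\<close>

text \<open>In contrast to \<open>piece_volume\<close>, the chosen submanifold depends on the
  measured set alone, so the piece from which that set was cut no longer appears. By
  \<open>area_eq\<close> the choice does not affect the value on Borel sets.\<close>

definition area :: "'m::finite itself \<Rightarrow> (real^'n::finite) set \<Rightarrow> ennreal" where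
  "area T C = emeasure (volume_measure T (SOME S. submanifold T S \<and> C \<subseteq> S)) C"

lemma area_eq:
  fixes S :: "(real^'n) set"
  assumes "submanifold TYPE('m::finite) S" "C \<in> sets borel" "C \<subseteq> S"
  shows "area TYPE('m) C = emeasure (volume_measure TYPE('m) S) C"
proof -
  have "\<exists>S. submanifold TYPE('m) S \<and> C \<subseteq> S" using assms by blast
  from someI_ex[OF this] show ?thesis
    unfolding area_def using assms by (intro emeasure_volume_measure_eq) auto
qed

lemma piece_volume_eq_area:
  fixes C :: "(real^'n) set"
  assumes "C \<in> borel_pieces TYPE('m::finite)" and A: "A \<in> sets borel"
  shows "piece_volume TYPE('m) C A = area TYPE('m) (A \<inter> C)"
proof -
  have C: "C \<in> sets borel" "\<exists>S. submanifold TYPE('m) S \<and> C \<subseteq> S"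
    using assms(1) by (auto simp: borel_pieces_def)
  from someI_ex[OF C(2)] show ?thesis
    unfolding piece_volume_def using A C(1) by (intro area_eq[symmetric]) auto
qed

lemma borel_pieces_Int_Diff:
  assumes "C \<in> borel_pieces T" "A \<in> sets borel"
  shows "A \<inter> C \<in> borel_pieces T" "C \<inter> A \<in> borel_pieces T" "C - A \<in> borel_pieces T"
  using assms by (auto simp: borel_pieces_def)

text \<open>One submanifold computes the area of all Borel subsets of \<open>C\<close>. Below a
  fixed piece, \<open>area\<close> thus inherits additivity and monotonicity from a genuine
  measure.\<close>

lemma borel_pieces_obtain:
  fixes C :: "(real^'n) set"
  assumes "C \<in> borel_pieces TYPE('m::finite)"
  obtains S where "submanifold TYPE('m) S" "C \<subseteq> S" "C \<in> sets borel"
    "\<And>B. B \<in> sets borel \<Longrightarrow> B \<subseteq> C \<Longrightarrow> B \<in> sets (volume_measure TYPE('m) S)"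
    "\<And>B. B \<in> sets borel \<Longrightarrow> B \<subseteq> C \<Longrightarrow> area TYPE('m) B = emeasure (volume_measure TYPE('m) S) B"
proof -
  obtain S where S: "submanifold TYPE('m) S" "C \<subseteq> S" "C \<in> sets borel"
    using assms by (auto simp: borel_pieces_def)
  show thesis
  proof (rule that[OF S])
    fix B :: "(real^'n) set" assume B: "B \<in> sets borel" "B \<subseteq> C"
    then show "B \<in> sets (volume_measure TYPE('m) S)"
      using S submanifold_borel[OF S(1)] by (simp add: sets_volume_measure sets_restrict_space_iff)
    show "area TYPE('m) B = emeasure (volume_measure TYPE('m) S) B"
      using B S by (intro area_eq) auto
  qed
qed

lemma sum_area_Int:
  fixes C :: "(real^'n) set"
  assumes C: "C \<in> borel_pieces TYPE('m::finite)"
    and D: "finite \<D>" "disjoint \<D>" "\<D> \<subseteq> sets borel"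
  shows "(\<Sum>D\<in>\<D>. area TYPE('m) (C \<inter> D)) = area TYPE('m) (C \<inter> \<Union>\<D>)"
proof -
  obtain S where S: "C \<in> sets borel"
    "\<And>B. B \<in> sets borel \<Longrightarrow> B \<subseteq> C \<Longrightarrow> B \<in> sets (volume_measure TYPE('m) S)"
    "\<And>B. B \<in> sets borel \<Longrightarrow> B \<subseteq> C \<Longrightarrow> area TYPE('m) B = emeasure (volume_measure TYPE('m) S) B"
    using borel_pieces_obtain[OF C] by metis
  have b: "C \<inter> D \<in> sets borel" if "D \<in> \<D>" for D using that D S(1) by auto
  have "(\<Sum>D\<in>\<D>. area TYPE('m) (C \<inter> D)) = (\<Sum>D\<in>\<D>. emeasure (volume_measure TYPE('m) S) (C \<inter> D))"
    by (intro sum.cong refl S(3) b) auto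
  also have "\<dots> = emeasure (volume_measure TYPE('m) S) (\<Union>D\<in>\<D>. C \<inter> D)"
  proof (rule sum_emeasure)
    show "(\<inter>) C ` \<D> \<subseteq> sets (volume_measure TYPE('m) S)"
      by (intro image_subsetI S(2) b) auto
    show "disjoint_family_on ((\<inter>) C) \<D>"
      using D(2) unfolding disjoint_family_on_def disjoint_def by blast
  qed (rule D(1))
  also have "(\<Union>D\<in>\<D>. C \<inter> D) = C \<inter> \<Union>\<D>" by auto
  also have "emeasure (volume_measure TYPE('m) S) (C \<inter> \<Union>\<D>) = area TYPE('m) (C \<inter> \<Union>\<D>)"
  proof (rule S(3)[symmetric])
    have "\<Union>\<D> \<in> sets borel" using D by (intro sets.finite_Union) auto
    then show "C \<inter> \<Union>\<D> \<in> sets borel" using S(1) by auto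
  qed auto
  finally show ?thesis .
qed

lemma area_mono:
  fixes C :: "(real^'n) set"
  assumes C: "C \<in> borel_pieces TYPE('m::finite)" and B: "B \<in> sets borel" "B \<subseteq> C"
  shows "area TYPE('m) B \<le> area TYPE('m) C"
proof -
  obtain S where "C \<in> sets borel"
    "\<And>B. B \<in> sets borel \<Longrightarrow> B \<subseteq> C \<Longrightarrow> B \<in> sets (volume_measure TYPE('m) S)"
    "\<And>B. B \<in> sets borel \<Longrightarrow> B \<subseteq> C \<Longrightarrow> area TYPE('m) B = emeasure (volume_measure TYPE('m) S) B"
    using borel_pieces_obtain[OF C] by metis
  then show ?thesis using B by (simp add: emeasure_mono)
qed

lemma suminf_area:
  fixes C :: "(real^'n) set"
  assumes C: "C \<in> borel_pieces TYPE('m::finite)"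
    and F: "range F \<subseteq> sets borel" "disjoint_family F"
  shows "(\<Sum>k. area TYPE('m) (F k \<inter> C)) = area TYPE('m) ((\<Union>k::nat. F k) \<inter> C)"
proof -
  obtain S where S: "C \<in> sets borel"
    "\<And>B. B \<in> sets borel \<Longrightarrow> B \<subseteq> C \<Longrightarrow> B \<in> sets (volume_measure TYPE('m) S)"
    "\<And>B. B \<in> sets borel \<Longrightarrow> B \<subseteq> C \<Longrightarrow> area TYPE('m) B = emeasure (volume_measure TYPE('m) S) B"
    using borel_pieces_obtain[OF C] by metis
  have b: "F k \<inter> C \<in> sets borel" for k using F S(1) by auto
  have bU: "(\<Union>k. F k) \<inter> C \<in> sets borel" using F S(1) by (intro sets.Int sets.countable_UN) auto
  have "(\<Sum>k. area TYPE('m) (F k \<inter> C)) = (\<Sum>k. emeasure (volume_measure TYPE('m) S) (F k \<inter> C))"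
    using S(3)[OF b] by simp
  also have "\<dots> = emeasure (volume_measure TYPE('m) S) (\<Union>k. F k \<inter> C)"
    using F S(2)[OF b] by (intro suminf_emeasure) (auto simp: disjoint_family_on_def)
  also have "\<dots> = area TYPE('m) ((\<Union>k. F k) \<inter> C)"
    using S(3)[OF bU] by simp
  finally show ?thesis .
qed

section \<open>Finite disjoint families of pieces and their directed supremum\<close>

definition piece_families :: "'m::finite itself \<Rightarrow> (real^'n::finite) set set set" where
  "piece_families T = {\<C>. finite \<C> \<and> disjoint \<C> \<and> \<C> \<subseteq> borel_pieces T}"

definition family_area :: "'m::finite itself \<Rightarrow> (real^'n::finite) set \<Rightarrow> (real^'n) set set \<Rightarrow> ennreal" where
  "family_area T A \<C> = (\<Sum>C\<in>\<C>. area T (A \<inter> C))"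

lemma piece_families_borel:
  assumes "\<C> \<in> piece_families T"
  shows "\<C> \<subseteq> sets borel" "\<Union>\<C> \<in> sets borel"
proof -
  show "\<C> \<subseteq> sets borel" using assms by (auto simp: piece_families_def borel_pieces_def)
  then show "\<Union>\<C> \<in> sets borel"
    using assms by (intro sets.finite_Union) (auto simp: piece_families_def)
qed

text \<open>The common refinement into sets \<open>A \<inter> C \<inter> D\<close> is summed in both
  orders. Applied in both directions to families with the same union, the inequality shows
  independence of the decomposition.\<close>

lemma family_area_mono:
  fixes A :: "(real^'n) set"
  assumes C: "\<C> \<in> piece_families TYPE('m::finite)" and D: "\<D> \<in> piece_families TYPE('m)"
    and sub: "\<Union>\<C> \<subseteq> \<Union>\<D>" and A: "A \<in> sets borel"
  shows "family_area TYPE('m) A \<C> \<le> family_area TYPE('m) A \<D>"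
proof -
  have "area TYPE('m) (A \<inter> C) = (\<Sum>D\<in>\<D>. area TYPE('m) ((A \<inter> C) \<inter> D))" if "C \<in> \<C>" for C
  proof -
    have "A \<inter> C \<in> borel_pieces TYPE('m)"
      using C A that by (auto simp: piece_families_def intro: borel_pieces_Int_Diff)
    then have "(\<Sum>D\<in>\<D>. area TYPE('m) ((A \<inter> C) \<inter> D)) = area TYPE('m) ((A \<inter> C) \<inter> \<Union>\<D>)"
      using D piece_families_borel[OF D] by (intro sum_area_Int) (auto simp: piece_families_def)
    also have "(A \<inter> C) \<inter> \<Union>\<D> = A \<inter> C" using sub that by blast
    finally show ?thesis ..
  qed
  then have "family_area TYPE('m) A \<C> = (\<Sum>C\<in>\<C>. \<Sum>D\<in>\<D>. area TYPE('m) ((A \<inter> C) \<inter> D))"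
    by (simp add: family_area_def)
  also have "\<dots> = (\<Sum>D\<in>\<D>. \<Sum>C\<in>\<C>. area TYPE('m) ((A \<inter> D) \<inter> C))"
    by (subst sum.swap) (simp add: Int_ac)
  also have "\<dots> \<le> family_area TYPE('m) A \<D>"
    unfolding family_area_def
  proof (rule sum_mono)
    fix D assume "D \<in> \<D>"
    then have p: "A \<inter> D \<in> borel_pieces TYPE('m)"
      using D A by (auto simp: piece_families_def intro: borel_pieces_Int_Diff)
    then have "(\<Sum>C\<in>\<C>. area TYPE('m) ((A \<inter> D) \<inter> C)) = area TYPE('m) ((A \<inter> D) \<inter> \<Union>\<C>)"
      using C piece_families_borel[OF C] by (intro sum_area_Int) (auto simp: piece_families_def)
    also have "\<dots> \<le> area TYPE('m) (A \<inter> D)"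
      using p piece_families_borel[OF C] by (intro area_mono) (auto simp: borel_pieces_def)
    finally show "(\<Sum>C\<in>\<C>. area TYPE('m) ((A \<inter> D) \<inter> C)) \<le> area TYPE('m) (A \<inter> D)" .
  qed
  finally show ?thesis .
qed

text \<open>Subtracting the union of the first family from each member of the second keeps the
  pieces Borel and makes the joint family disjoint.\<close>

lemma piece_families_directed:
  assumes C: "\<C> \<in> piece_families T" and D: "\<D> \<in> piece_families T"
  obtains \<E> where "\<E> \<in> piece_families T" "\<Union>\<C> \<subseteq> \<Union>\<E>" "\<Union>\<D> \<subseteq> \<Union>\<E>"
proof
  let ?E = "\<C> \<union> (\<lambda>D. D - \<Union>\<C>) ` \<D>"
  have "disjoint ?E"
  proof (rule disjoint_union)
    show "disjoint \<C>" using C by (simp add: piece_families_def)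
    show "disjoint ((\<lambda>D. D - \<Union>\<C>) ` \<D>)"
      using D by (auto simp: piece_families_def disjoint_def)
    show "\<Union>\<C> \<inter> \<Union>((\<lambda>D. D - \<Union>\<C>) ` \<D>) = {}" by blast
  qed
  then show "?E \<in> piece_families T"
    using C D piece_families_borel[OF C]
    by (auto simp: piece_families_def intro!: borel_pieces_Int_Diff)
qed auto

text \<open>Replaces the decomposition selected by \<open>SOME\<close> for each union by a supremum
  over all families, using that families with the same union have the same
  \<open>family_area\<close>.\<close>

lemma inductive_volume_eq_SUP:
  fixes A :: "(real^'n) set"
  assumes A: "A \<in> sets borel"
  shows "inductive_volume TYPE('m::finite) A = (SUP \<C>\<in>piece_families TYPE('m). family_area TYPE('m) A \<C>)"
proof -
  define \<D> where "\<D> M = (SOME \<C>. is_decomposition TYPE('m) M \<C>)" for M :: "(real^'n) set"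
  have D: "\<D> M \<in> piece_families TYPE('m)" "\<Union>(\<D> M) = M" "union_volume TYPE('m) M A = family_area TYPE('m) A (\<D> M)"
    if "M \<in> finite_unions TYPE('m)" for M
  proof -
    have "\<exists>\<C>. is_decomposition TYPE('m) M \<C>" using that by (simp add: finite_unions_def)
    from someI_ex[OF this] show *: "\<D> M \<in> piece_families TYPE('m)" "\<Union>(\<D> M) = M"
      by (auto simp: \<D>_def is_decomposition_def piece_families_def)
    show "union_volume TYPE('m) M A = family_area TYPE('m) A (\<D> M)"
      unfolding union_volume_def family_area_def \<D>_def[symmetric]
      using *(1) A by (intro sum.cong piece_volume_eq_area) (auto simp: piece_families_def)
  qed
  show ?thesis
    unfolding inductive_volume_def
  proof (intro antisym SUP_least)
    fix M :: "(real^'n) set" assume "M \<in> finite_unions TYPE('m)"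
    then show "union_volume TYPE('m) M A \<le> (SUP \<C>\<in>piece_families TYPE('m). family_area TYPE('m) A \<C>)"
      using D by (auto intro!: SUP_upper)
  next
    fix \<C> :: "(real^'n) set set" assume C: "\<C> \<in> piece_families TYPE('m)"
    then have M: "\<Union>\<C> \<in> finite_unions TYPE('m)"
      by (auto simp: finite_unions_def is_decomposition_def piece_families_def)
    have "family_area TYPE('m) A \<C> \<le> family_area TYPE('m) A (\<D> (\<Union>\<C>))"
      using C D[OF M] A by (intro family_area_mono) auto
    also have "\<dots> = union_volume TYPE('m) (\<Union>\<C>) A" using D(3)[OF M] by simp
    also have "\<dots> \<le> (SUP M\<in>finite_unions TYPE('m). union_volume TYPE('m) M A)"
      using M by (rule SUP_upper)
    finally show "family_area TYPE('m) A \<C> \<le> (SUP M\<in>finite_unions TYPE('m). union_volume TYPE('m) M A)" .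
  qed
qed

text \<open>For a fixed family, \<open>family_area\<close> is countably additive in the measured
  set. A countable sum of nonnegative terms commutes with a supremum over a directed index set, so
  additivity passes to the limit.\<close>

lemma inductive_volume_countably_additive:
  "countably_additive (sets borel) (inductive_volume TYPE('m::finite) :: (real^'n) set \<Rightarrow> ennreal)"
proof (rule countably_additiveI)
  fix F :: "nat \<Rightarrow> (real^'n) set"
  assume F: "range F \<subseteq> sets borel" "disjoint_family F" "\<Union>(range F) \<in> sets borel"
  let ?P = "piece_families TYPE('m) :: (real^'n) set set set"
  have "(\<Sum>k. inductive_volume TYPE('m) (F k)) = (\<Sum>k. SUP \<C>\<in>?P. family_area TYPE('m) (F k) \<C>)"
    using F by (intro suminf_cong inductive_volume_eq_SUP) auto
  also have "\<dots> = (SUP \<C>\<in>?P. \<Sum>k. family_area TYPE('m) (F k) \<C>)"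
  proof (rule ennreal_suminf_SUP_eq_directed)
    fix N :: "nat set" and \<C> \<D> :: "(real^'n) set set" assume "\<C> \<in> ?P" "\<D> \<in> ?P"
    then obtain \<E> where E: "\<E> \<in> ?P" "\<Union>\<C> \<subseteq> \<Union>\<E>" "\<Union>\<D> \<subseteq> \<Union>\<E>"
      by (rule piece_families_directed)
    then show "\<exists>\<E>\<in>?P. \<forall>k\<in>N. family_area TYPE('m) (F k) \<C> \<le> family_area TYPE('m) (F k) \<E> \<and>
        family_area TYPE('m) (F k) \<D> \<le> family_area TYPE('m) (F k) \<E>"
      using \<open>\<C> \<in> ?P\<close> \<open>\<D> \<in> ?P\<close> F(1) by (intro bexI[of _ \<E>]) (auto intro!: family_area_mono)
  qed
  also have "\<dots> = (SUP \<C>\<in>?P. family_area TYPE('m) (\<Union>(range F)) \<C>)"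
  proof (intro SUP_cong refl)
    fix \<C> assume C: "\<C> \<in> ?P"
    have "(\<Sum>k. family_area TYPE('m) (F k) \<C>) = (\<Sum>C\<in>\<C>. \<Sum>k. area TYPE('m) (F k \<inter> C))"
      unfolding family_area_def by (rule suminf_sum) simp
    also have "\<dots> = family_area TYPE('m) (\<Union>(range F)) \<C>"
      unfolding family_area_def using C F
      by (intro sum.cong refl suminf_area) (auto simp: piece_families_def)
    finally show "(\<Sum>k. family_area TYPE('m) (F k) \<C>) = family_area TYPE('m) (\<Union>(range F)) \<C>" .
  qed
  also have "\<dots> = inductive_volume TYPE('m) (\<Union>(range F))"
    using F(3) by (rule inductive_volume_eq_SUP[symmetric])
  finally show "(\<Sum>k. inductive_volume TYPE('m) (F k)) = inductive_volume TYPE('m) (\<Union>(range F))" .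
qed

lemma submanifold_empty: "submanifold T {}"
  by (simp add: submanifold_def)

lemma area_empty [simp]: "area TYPE('m::finite) {} = 0"
  using area_eq[OF submanifold_empty, of "{}"] by simp

lemma inductive_volume_positive:
  "positive (sets borel) (inductive_volume TYPE('m::finite) :: (real^'n) set \<Rightarrow> ennreal)"
proof -
  have "{} \<in> piece_families TYPE('m)" by (simp add: piece_families_def)
  then have "piece_families TYPE('m) \<noteq> ({} :: (real^'n) set set set)" by blast
  then show ?thesis
    by (simp add: positive_def inductive_volume_eq_SUP family_area_def)
qed

section \<open>The inductive volume as a measure and the Area Formula\<close>

lemma sets_inductive_volume_measure [simp]:
  "sets (inductive_volume_measure T) = sets borel"
  unfolding inductive_volume_measure_def
  by (metis sets.sets_measure_of_eq space_borel)

lemma emeasure_inductive_volume_measure: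
  fixes A :: "(real^'n) set"
  assumes "A \<in> sets borel"
  shows "emeasure (inductive_volume_measure TYPE('m::finite)) A = inductive_volume TYPE('m) A"
  using inductive_volume_positive inductive_volume_countably_additive assms
  by (intro emeasure_measure_of[OF inductive_volume_measure_def]) auto

text \<open>A family sees only the part of \<open>B\<close> inside its union, so it contributes at
  most the area of \<open>B\<close>; the one-member family \<open>{B}\<close> attains this
  bound.\<close>

lemma inductive_volume_piece:
  fixes B :: "(real^'n) set"
  assumes B: "B \<in> borel_pieces TYPE('m::finite)"
  shows "inductive_volume TYPE('m) B = area TYPE('m) B"
proof -
  have b: "B \<in> sets borel" using B by (simp add: borel_pieces_def)
  show ?thesis
    unfolding inductive_volume_eq_SUP[OF b]
  proof (intro antisym SUP_least)
    fix \<C> :: "(real^'n) set set" assume C: "\<C> \<in> piece_families TYPE('m)"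
    have "family_area TYPE('m) B \<C> = area TYPE('m) (B \<inter> \<Union>\<C>)"
      unfolding family_area_def using C piece_families_borel[OF C]
      by (intro sum_area_Int B) (auto simp: piece_families_def)
    also have "\<dots> \<le> area TYPE('m) B"
      using b piece_families_borel[OF C] by (intro area_mono B) auto
    finally show "family_area TYPE('m) B \<C> \<le> area TYPE('m) B" .
  next
    have "{B} \<in> piece_families TYPE('m)" using B by (simp add: piece_families_def)
    then have "family_area TYPE('m) B {B} \<le> (SUP \<C>\<in>piece_families TYPE('m). family_area TYPE('m) B \<C>)"
      by (rule SUP_upper)
    then show "area TYPE('m) B \<le> (SUP \<C>\<in>piece_families TYPE('m). family_area TYPE('m) B \<C>)"
      by (simp add: family_area_def)
  qed
qed

text \<open>Each \<open>A \<inter> M k\<close> is a piece, on which the inductive volume is the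
  volume of \<open>M k\<close>; the rest is countable additivity.\<close>

lemma inductive_volume_area_formula:
  "satisfies_area_formula TYPE('m::finite) (inductive_volume_measure TYPE('m) :: (real^'n) measure)"
  unfolding satisfies_area_formula_def
proof (intro allI impI)
  fix M :: "nat \<Rightarrow> (real^'n) set" and A :: "(real^'n) set"
  assume M: "\<forall>k. submanifold TYPE('m) (M k)" "disjoint_family M" and A: "A \<in> sets borel" "A \<subseteq> (\<Union>k. M k)"
  have b: "A \<inter> M k \<in> sets borel" for k
    using M(1) A(1) submanifold_borel by blast
  have "emeasure (inductive_volume_measure TYPE('m)) (A \<inter> M k) = emeasure (volume_measure TYPE('m) (M k)) (A \<inter> M k)" for k
  proof -
    have "A \<inter> M k \<in> borel_pieces TYPE('m)" using b M(1) by (auto simp: borel_pieces_def)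
    then show ?thesis
      using M(1) b
      by (simp add: emeasure_inductive_volume_measure inductive_volume_piece area_eq[where S = "M k"])
  qed
  moreover have "(\<Sum>k. emeasure (inductive_volume_measure TYPE('m)) (A \<inter> M k)) =
      emeasure (inductive_volume_measure TYPE('m)) (\<Union>k. A \<inter> M k)"
    using M(2) b by (intro suminf_emeasure) (auto simp: disjoint_family_on_def)
  moreover have "(\<Union>k. A \<inter> M k) = A" using A(2) by blast
  ultimately show "emeasure (inductive_volume_measure TYPE('m)) A =
      (\<Sum>k. emeasure (volume_measure TYPE('m) (M k)) (A \<inter> M k))"
    by simp
qed

section \<open>Inner regularity on sets of finite measure\<close>

lemma inner_regular_on_finite_borel:
  fixes \<nu> :: "(real^'n) measure"
  assumes s: "sets \<nu> = sets borel"
  shows "inner_regular_on_finite \<nu>"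
  unfolding inner_regular_on_finite_def
proof (intro ballI impI)
  fix A :: "(real^'n) set" assume A: "A \<in> sets borel" "emeasure \<nu> A < \<infinity>"
  \<comment> \<open>Restricting \<open>\<nu>\<close> to \<open>A\<close> by a density gives a finite
    Borel measure on the whole space, to which inner regularity by compact sets applies. Subsets of
    \<open>A\<close> keep their measure.\<close>
  define N where "N = density \<nu> (indicator A)"
  have N: "emeasure N B = emeasure \<nu> (A \<inter> B)" if "B \<in> sets borel" for B
    unfolding N_def using A that s by (simp add: emeasure_density nn_integral_indicator flip: indicator_inter_arith)
  have sp: "space N = UNIV" unfolding N_def using sets_eq_imp_space_eq[OF s] by simp
  have "emeasure N A = (SUP K\<in>{K. K \<subseteq> A \<and> compact K}. emeasure N K)"
  proof (rule inner_regular)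
    show "sets N = sets borel" by (simp add: N_def s)
    show "emeasure N (space N) \<noteq> \<infinity>" using A N[of UNIV] sp by simp
  qed (rule A)
  also have "\<dots> = (SUP K\<in>{K. compact K \<and> K \<subseteq> A}. emeasure \<nu> K)"
    by (intro SUP_cong) (auto simp: N borel_compact inf.absorb2)
  also have "emeasure N A = emeasure \<nu> A" using N A by simp
  finally show "emeasure \<nu> A = (SUP K\<in>{K. compact K \<and> K \<subseteq> A}. emeasure \<nu> K)" .
qed

section \<open>Minimality\<close>

lemma area_formula_piece:
  fixes \<nu> :: "(real^'n) measure"
  assumes \<nu>: "satisfies_area_formula TYPE('m::finite) \<nu>" and C: "C \<in> borel_pieces TYPE('m)"
  shows "emeasure \<nu> C = area TYPE('m) C"
proof -
  obtain S where S: "submanifold TYPE('m) S" "C \<subseteq> S" "C \<in> sets borel"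
    using C by (auto simp: borel_pieces_def)
  \<comment> \<open>The Area Formula speaks of infinite sequences, so the single submanifold
    \<open>S\<close> is padded with empty submanifolds, which are disjoint from everything and add
    0.\<close>
  define M where "M k = (if k = 0 then S else {})" for k :: nat
  have "emeasure \<nu> C = (\<Sum>k. emeasure (volume_measure TYPE('m) (M k)) (C \<inter> M k))"
    using \<nu> S unfolding satisfies_area_formula_def
    by (elim allE[of _ M] allE[of _ C]) (auto simp: M_def submanifold_empty disjoint_family_on_def)
  also have "\<dots> = (\<Sum>k\<in>{0}. emeasure (volume_measure TYPE('m) (M k)) (C \<inter> M k))"
    by (rule suminf_finite) (auto simp: M_def)
  also have "\<dots> = area TYPE('m) C"
    using S by (simp add: M_def area_eq[OF S(1,3,2)] inf.absorb1)
  finally show ?thesis .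
qed

text \<open>For each finite family, the Area Formula identifies \<open>family_area\<close> with the
  \<open>\<nu>\<close>-measure of the part of \<open>A\<close> inside the union of the family, and
  this is at most the measure of \<open>A\<close>.\<close>

lemma inductive_volume_least:
  fixes \<nu> :: "(real^'n) measure"
  assumes s: "sets \<nu> = sets borel" and \<nu>: "satisfies_area_formula TYPE('m::finite) \<nu>" and A: "A \<in> sets borel"
  shows "inductive_volume TYPE('m) A \<le> emeasure \<nu> A"
  unfolding inductive_volume_eq_SUP[OF A]
proof (rule SUP_least)
  fix \<C> :: "(real^'n) set set" assume C: "\<C> \<in> piece_families TYPE('m)"
  have p: "A \<inter> C \<in> borel_pieces TYPE('m)" if "C \<in> \<C>" for C
    using C A that by (auto simp: piece_families_def intro: borel_pieces_Int_Diff)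
  have "family_area TYPE('m) A \<C> = (\<Sum>C\<in>\<C>. emeasure \<nu> (A \<inter> C))"
    unfolding family_area_def using area_formula_piece[OF \<nu> p] by simp
  also have "\<dots> = emeasure \<nu> (\<Union>C\<in>\<C>. A \<inter> C)"
  proof (rule sum_emeasure)
    show "(\<inter>) A ` \<C> \<subseteq> sets \<nu>"
      using p s by (auto simp: borel_pieces_def)
    show "disjoint_family_on ((\<inter>) A) \<C>"
      using C unfolding piece_families_def disjoint_family_on_def disjoint_def by blast
    show "finite \<C>"
      using C by (simp add: piece_families_def)
  qed
  also have "\<dots> \<le> emeasure \<nu> A"
    using A s by (intro emeasure_mono) auto
  finally show "family_area TYPE('m) A \<C> \<le> emeasure \<nu> A" .
qed

theorem corollary3p2:
  assumes "CARD('m::finite) \<le> CARD('n::finite)"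
  shows "measure_space (UNIV :: (real^'n) set) (sets borel) (inductive_volume TYPE('m))
    \<and> satisfies_area_formula TYPE('m) (inductive_volume_measure TYPE('m) :: (real^'n) measure)
    \<and> inner_regular_on_finite (inductive_volume_measure TYPE('m) :: (real^'n) measure)
    \<and> (\<forall>\<nu> :: (real^'n) measure.
          sets \<nu> = sets borel \<longrightarrow> satisfies_area_formula TYPE('m) \<nu> \<longrightarrow> inner_regular_on_finite \<nu> \<longrightarrow>
          (\<forall>A\<in>sets borel. emeasure (inductive_volume_measure TYPE('m)) A \<le> emeasure \<nu> A))"
proof (intro conjI allI impI ballI)
  \<comment> \<open>This conjunct ensures that \<open>inductive_volume_measure\<close> really
    carries the values of \<open>inductive_volume\<close> and is not the null measure that
    \<open>measure_of\<close> returns by default.\<close>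
  show "measure_space (UNIV :: (real^'n) set) (sets borel) (inductive_volume TYPE('m))"
    unfolding measure_space_def
    using inductive_volume_positive inductive_volume_countably_additive
      sets.sigma_algebra_axioms[of "borel :: (real^'n) measure"] by simp
qed (auto simp: inductive_volume_area_formula emeasure_inductive_volume_measure
  intro: inner_regular_on_finite_borel inductive_volume_least)

end
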